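(* Let $\sigma$ be a multi-sorted algebraic signature and let $\mathcal{C}$ be a finite product category that is free on $\sigma$ via an interpretation $i:\sigma\to\mathcal{C}$. Let $\mathcal{D}$ be a 2-category with finite 2-categorical products and let $M,N:\sigma\to\mathcal{D}$ be interpretations. Let $\widetilde{M},\widetilde{N}:\mathcal{C}\to\mathcal{D}$ be the unique finite-product-preserving functors with $\widetilde{M}\circ i=M$ and $\widetilde{N}\circ i=N$. Then $M$ and $N$ are homotopy-equivalent if and only if $\widetilde{M}$ and $\widetilde{N}$ are pseudonaturally equivalent.
   Context: An algebraic signature $\sigma$ consists of a set of sorts and, for each finite sequence $\vec A$ of sorts and sort $B$, a set $\sigma(\vec A,B)$ of function symbols. An interpretation $M$ of $\sigma$ in a finite product category $\mathcal{E}$ consists of an object $MA$ for each sort, a chosen product diagram $\{\pi_i:M\vec A\to MA_i\}$ for each finite sequence $\vec A$ (with $M\langle A\rangle=MA$, $\pi_1=\mathrm{id}$), and a morphism $Mf:M\vec A\to MB$ for each $f\in\sigma(\vec A,B)$. Homomorphisms $\alpha:M\to N$ are families $\alpha_A:MA\to NA$ with $\alpha_B\circ Mf=Nf\circ\alpha_{\vec A}$, where $\alpha_{\vec A}=\alpha_{A_1}\times\cdots\times\alpha_{A_n}$; these form a category $\mathrm{Int}(\sigma,\mathcal{E})$. For a finite-product-preserving (f.p.) functor $F:\mathcal{E}\to\mathcal{E}'$, $F\circ M$ is the interpretation $A\mapsto F(MA)$, $\vec A\mapsto F(M\vec A)$ with projections $F\pi_i$, $f\mapsto F(Mf)$; this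 extends to a functor $\mathrm{FPFun}(\mathcal{E},\mathcal{E}')\to\mathrm{Int}(\sigma,\mathcal{E}')$. $\mathcal{C}$ is free on $\sigma$ via $i$ if this functor (for $M=i$) is an isomorphism of categories for every finite product category $\mathcal{E}'$. A 2-categorical product of $A,B$ is a product in the underlying category such that for every $X$ the induced functor $\mathrm{HOM}(X,A\times B)\to\mathrm{HOM}(X,A)\times\mathrm{HOM}(X,B)$ is an isomorphism of categories. Given interpretations $M,N:\sigma\to\mathcal{D}$, a homotopy homomorphism $\alpha:M\to N$ consists of 1-cells $\alpha_A:MA\to NA$ and invertible 2-cells $\alpha_f:\alpha_B\circ Mf\Rightarrow Nf\circ\alpha_{\vec A}$ for each $f\in\sigma(\vec A,B)$; it is a homotopy-equivalence if each $\alpha_A$ is an equivalence in $\mathcal{D}$ (a 1-cell with a quasi-inverse up to invertible 2-cells). For functors $F,G$ from a category to $\mathcal{D}$, a pseudonatural transformation $\beta:F\to G$ consists of 1-cells $\beta_X:FX\to GX$ and invertible 2-cells $\beta_f:\beta_Y\circ Ff\Rightarrow Gf\circ\beta_X$ with $(\mathrm{id}_{Gg}\circ\beta_f)(\beta_g\circ\mathrm{id}_{Ff})=\beta_{gf}$ and $\beta_{\mathrm{id}}=\mathrm{id}$; it is a pseudonatural equivalence if every $\beta_X$ is an equivalence. *)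

theory Defs
  imports "HOL-Library.FuncSet"
begin

record ('o, 'm) cat =
  Ob :: "'o set"
  Ar :: "'m set"
  Dom :: "'m \<Rightarrow> 'o"
  Cod :: "'m \<Rightarrow> 'o"
  Ide :: "'o \<Rightarrow> 'm"
  Comp :: "'m \<Rightarrow> 'm \<Rightarrow> 'm"  (infixl "\<cdot>\<index>" 70)

definition hom :: "('o, 'm) cat \<Rightarrow> 'o \<Rightarrow> 'o \<Rightarrow> 'm set" where
  "hom C X Y = {f \<in> Ar C. Dom C f = X \<and> Cod C f = Y}"

locale category =
  fixes C :: "('o, 'm) cat"
  assumes Dom_in: "f \<in> Ar C \<Longrightarrow> Dom C f \<in> Ob C"
    and Cod_in: "f \<in> Ar C \<Longrightarrow> Cod C f \<in> Ob C"
    and Ide_in: "X \<in> Ob C \<Longrightarrow> Ide C X \<in> hom C X X"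
    and Comp_in: "f \<in> hom C X Y \<Longrightarrow> g \<in> hom C Y Z \<Longrightarrow> g \<cdot>\<^bsub>C\<^esub> f \<in> hom C X Z"
    and Comp_assoc: "f \<in> hom C W X \<Longrightarrow> g \<in> hom C X Y \<Longrightarrow> h \<in> hom C Y Z
      \<Longrightarrow> h \<cdot>\<^bsub>C\<^esub> g \<cdot>\<^bsub>C\<^esub> f = h \<cdot>\<^bsub>C\<^esub> (g \<cdot>\<^bsub>C\<^esub> f)"
    and Comp_Ide: "f \<in> hom C X Y \<Longrightarrow> f \<cdot>\<^bsub>C\<^esub> Ide C X = f"
    and Ide_Comp: "f \<in> hom C X Y \<Longrightarrow> Ide C Y \<cdot>\<^bsub>C\<^esub> f = f"

definition isos :: "('o, 'm) cat \<Rightarrow> 'o \<Rightarrow> 'o \<Rightarrow> 'm set" where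
  "isos C X Y = {f \<in> hom C X Y. \<exists>g \<in> hom C Y X. g \<cdot>\<^bsub>C\<^esub> f = Ide C X \<and> f \<cdot>\<^bsub>C\<^esub> g = Ide C Y}"

text \<open>Functors, natural transformations, interpretations and homomorphisms of interpretations
  are made of extensional functions (with value \<^const>\<open>undefined\<close> outside the intended domain),
  so that HOL equality is the mathematical equality of these objects.\<close>

record ('o, 'm, 'p, 'n) ftr =
  On_ob :: "'o \<Rightarrow> 'p"
  On_ar :: "'m \<Rightarrow> 'n"

definition is_functor :: "('o, 'm) cat \<Rightarrow> ('p, 'n) cat \<Rightarrow> ('o, 'm, 'p, 'n) ftr \<Rightarrow> bool" where
  "is_functor A B F \<longleftrightarrow>
     category A \<and> category B \<and>
     On_ob F \<in> Ob A \<rightarrow>\<^sub>E Ob B \<and>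
     On_ar F \<in> extensional (Ar A) \<and>
     (\<forall>X Y. \<forall>f \<in> hom A X Y. On_ar F f \<in> hom B (On_ob F X) (On_ob F Y)) \<and>
     (\<forall>X \<in> Ob A. On_ar F (Ide A X) = Ide B (On_ob F X)) \<and>
     (\<forall>X Y Z. \<forall>f \<in> hom A X Y. \<forall>g \<in> hom A Y Z.
        On_ar F (g \<cdot>\<^bsub>A\<^esub> f) = On_ar F g \<cdot>\<^bsub>B\<^esub> On_ar F f)"

definition id_functor :: "('o, 'm) cat \<Rightarrow> ('o, 'm, 'o, 'm) ftr" where
  "id_functor A = \<lparr>On_ob = (\<lambda>X\<in>Ob A. X), On_ar = (\<lambda>f\<in>Ar A. f)\<rparr>"

definition comp_functor ::
  "('o, 'm) cat \<Rightarrow> ('p, 'n, 'q, 'k) ftr \<Rightarrow> ('o, 'm, 'p, 'n) ftr \<Rightarrow> ('o, 'm, 'q, 'k) ftr" where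
  "comp_functor A G F =
     \<lparr>On_ob = compose (Ob A) (On_ob G) (On_ob F), On_ar = compose (Ar A) (On_ar G) (On_ar F)\<rparr>"

definition iso_of_cats :: "('o, 'm) cat \<Rightarrow> ('p, 'n) cat \<Rightarrow> ('o, 'm, 'p, 'n) ftr \<Rightarrow> bool" where
  "iso_of_cats A B F \<longleftrightarrow> is_functor A B F \<and>
     (\<exists>G. is_functor B A G \<and> comp_functor A G F = id_functor A \<and> comp_functor B F G = id_functor B)"

definition nat_trans :: "('o, 'm) cat \<Rightarrow> ('p, 'n) cat \<Rightarrow> ('o, 'm, 'p, 'n) ftr \<Rightarrow>
    ('o, 'm, 'p, 'n) ftr \<Rightarrow> ('o \<Rightarrow> 'n) \<Rightarrow> bool" where
  "nat_trans A B F G \<tau> \<longleftrightarrow>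
     is_functor A B F \<and> is_functor A B G \<and>
     \<tau> \<in> extensional (Ob A) \<and>
     (\<forall>X \<in> Ob A. \<tau> X \<in> hom B (On_ob F X) (On_ob G X)) \<and>
     (\<forall>X Y. \<forall>f \<in> hom A X Y. \<tau> Y \<cdot>\<^bsub>B\<^esub> On_ar F f = On_ar G f \<cdot>\<^bsub>B\<^esub> \<tau> X)"

text \<open>Products are those of finite lists of objects; the empty list gives terminal objects.\<close>

definition cone :: "('o, 'm) cat \<Rightarrow> 'o \<Rightarrow> 'o list \<Rightarrow> 'm list \<Rightarrow> bool" where
  "cone C X As fs \<longleftrightarrow> X \<in> Ob C \<and> list_all2 (\<lambda>f A. f \<in> hom C X A) fs As"

definition is_product :: "('o, 'm) cat \<Rightarrow> 'o \<Rightarrow> 'o list \<Rightarrow> 'm list \<Rightarrow> bool" where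
  "is_product C P As ps \<longleftrightarrow> cone C P As ps \<and>
     (\<forall>X fs. cone C X As fs \<longrightarrow> (\<exists>!h. h \<in> hom C X P \<and> map (\<lambda>p. p \<cdot>\<^bsub>C\<^esub> h) ps = fs))"

definition fp_category :: "('o, 'm) cat \<Rightarrow> bool" where
  "fp_category C \<longleftrightarrow> category C \<and> (\<forall>As. set As \<subseteq> Ob C \<longrightarrow> (\<exists>P ps. is_product C P As ps))"

definition fp_functor :: "('o, 'm) cat \<Rightarrow> ('p, 'n) cat \<Rightarrow> ('o, 'm, 'p, 'n) ftr \<Rightarrow> bool" where
  "fp_functor A B F \<longleftrightarrow> is_functor A B F \<and>
     (\<forall>P As ps. is_product A P As ps \<longrightarrow>
        is_product B (On_ob F P) (map (On_ob F) As) (map (On_ar F) ps))"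

definition FPFun :: "('o, 'm) cat \<Rightarrow> ('p, 'n) cat \<Rightarrow>
    (('o, 'm, 'p, 'n) ftr, ('o, 'm, 'p, 'n) ftr \<times> ('o, 'm, 'p, 'n) ftr \<times> ('o \<Rightarrow> 'n)) cat" where
  "FPFun A B =
     \<lparr>Ob = {F. fp_functor A B F},
      Ar = {(F, G, \<tau>). fp_functor A B F \<and> fp_functor A B G \<and> nat_trans A B F G \<tau>},
      Dom = (\<lambda>(F, G, \<tau>). F),
      Cod = (\<lambda>(F, G, \<tau>). G),
      Ide = (\<lambda>F. (F, F, \<lambda>X\<in>Ob A. Ide B (On_ob F X))),
      Comp = (\<lambda>(_, H, \<upsilon>) (F, _, \<tau>). (F, H, \<lambda>X\<in>Ob A. \<upsilon> X \<cdot>\<^bsub>B\<^esub> \<tau> X))\<rparr>"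

record ('s, 'f) signature =
  Sorts :: "'s set"
  Sym :: "'s list \<Rightarrow> 's \<Rightarrow> 'f set"

text \<open>The sets \<^term>\<open>Sym \<sigma> As B\<close> need not be disjoint, so a function symbol is used together with
  its arity.\<close>

definition Ops :: "('s, 'f) signature \<Rightarrow> ('s list \<times> 's \<times> 'f) set" where
  "Ops \<sigma> = {(As, B, f). As \<in> lists (Sorts \<sigma>) \<and> B \<in> Sorts \<sigma> \<and> f \<in> Sym \<sigma> As B}"

text \<open>The object interpreting a sort \<open>A\<close> is \<^term>\<open>I_ob M [A]\<close>; this builds in the convention that
  the chosen product of a one-element sequence is the object itself.\<close>

record ('s, 'f, 'o, 'm) interp =
  I_ob :: "'s list \<Rightarrow> 'o"
  I_pr :: "'s list \<Rightarrow> 'm list"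
  I_op :: "'s list \<times> 's \<times> 'f \<Rightarrow> 'm"

definition is_interp :: "('s, 'f) signature \<Rightarrow> ('o, 'm) cat \<Rightarrow> ('s, 'f, 'o, 'm) interp \<Rightarrow> bool" where
  "is_interp \<sigma> E M \<longleftrightarrow>
     I_ob M \<in> extensional (lists (Sorts \<sigma>)) \<and>
     I_pr M \<in> extensional (lists (Sorts \<sigma>)) \<and>
     I_op M \<in> extensional (Ops \<sigma>) \<and>
     (\<forall>As \<in> lists (Sorts \<sigma>). is_product E (I_ob M As) (map (\<lambda>A. I_ob M [A]) As) (I_pr M As)) \<and>
     (\<forall>A \<in> Sorts \<sigma>. I_pr M [A] = [Ide E (I_ob M [A])]) \<and>
     (\<forall>(As, B, f) \<in> Ops \<sigma>. I_op M (As, B, f) \<in> hom E (I_ob M As) (I_ob M [B]))"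

text \<open>The product of the arrows \<open>\<alpha> A\<close>, for \<open>A\<close> in the sequence \<open>As\<close>, with respect to the product
  diagrams chosen by \<open>M\<close> and \<open>N\<close>.\<close>

definition prod_map :: "('o, 'm) cat \<Rightarrow> ('s, 'f, 'o, 'm) interp \<Rightarrow> ('s, 'f, 'o, 'm) interp \<Rightarrow>
    ('s \<Rightarrow> 'm) \<Rightarrow> 's list \<Rightarrow> 'm" where
  "prod_map E M N \<alpha> As =
     (THE h. h \<in> hom E (I_ob M As) (I_ob N As) \<and>
        map (\<lambda>p. p \<cdot>\<^bsub>E\<^esub> h) (I_pr N As) = map2 (\<lambda>A p. \<alpha> A \<cdot>\<^bsub>E\<^esub> p) As (I_pr M As))"

definition is_hom :: "('s, 'f) signature \<Rightarrow> ('o, 'm) cat \<Rightarrow> ('s, 'f, 'o, 'm) interp \<Rightarrow>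
    ('s, 'f, 'o, 'm) interp \<Rightarrow> ('s \<Rightarrow> 'm) \<Rightarrow> bool" where
  "is_hom \<sigma> E M N \<alpha> \<longleftrightarrow>
     \<alpha> \<in> extensional (Sorts \<sigma>) \<and>
     (\<forall>A \<in> Sorts \<sigma>. \<alpha> A \<in> hom E (I_ob M [A]) (I_ob N [A])) \<and>
     (\<forall>(As, B, f) \<in> Ops \<sigma>.
        \<alpha> B \<cdot>\<^bsub>E\<^esub> I_op M (As, B, f) = I_op N (As, B, f) \<cdot>\<^bsub>E\<^esub> prod_map E M N \<alpha> As)"

definition Int_cat :: "('s, 'f) signature \<Rightarrow> ('o, 'm) cat \<Rightarrow>
    (('s, 'f, 'o, 'm) interp,
     ('s, 'f, 'o, 'm) interp \<times> ('s, 'f, 'o, 'm) interp \<times> ('s \<Rightarrow> 'm)) cat" where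
  "Int_cat \<sigma> E =
     \<lparr>Ob = {M. is_interp \<sigma> E M},
      Ar = {(M, N, \<alpha>). is_interp \<sigma> E M \<and> is_interp \<sigma> E N \<and> is_hom \<sigma> E M N \<alpha>},
      Dom = (\<lambda>(M, N, \<alpha>). M),
      Cod = (\<lambda>(M, N, \<alpha>). N),
      Ide = (\<lambda>M. (M, M, \<lambda>A\<in>Sorts \<sigma>. Ide E (I_ob M [A]))),
      Comp = (\<lambda>(_, K, \<beta>) (M, _, \<alpha>). (M, K, \<lambda>A\<in>Sorts \<sigma>. \<beta> A \<cdot>\<^bsub>E\<^esub> \<alpha> A))\<rparr>"

definition functor_interp :: "('s, 'f) signature \<Rightarrow> ('o, 'm, 'p, 'n) ftr \<Rightarrow>
    ('s, 'f, 'o, 'm) interp \<Rightarrow> ('s, 'f, 'p, 'n) interp" where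
  "functor_interp \<sigma> F M =
     \<lparr>I_ob = (\<lambda>As\<in>lists (Sorts \<sigma>). On_ob F (I_ob M As)),
      I_pr = (\<lambda>As\<in>lists (Sorts \<sigma>). map (On_ar F) (I_pr M As)),
      I_op = (\<lambda>x\<in>Ops \<sigma>. On_ar F (I_op M x))\<rparr>"

definition eval_functor :: "('s, 'f) signature \<Rightarrow> ('o, 'm) cat \<Rightarrow> ('s, 'f, 'o, 'm) interp \<Rightarrow>
    ('p, 'n) cat \<Rightarrow>
    (('o, 'm, 'p, 'n) ftr, ('o, 'm, 'p, 'n) ftr \<times> ('o, 'm, 'p, 'n) ftr \<times> ('o \<Rightarrow> 'n),
     ('s, 'f, 'p, 'n) interp,
     ('s, 'f, 'p, 'n) interp \<times> ('s, 'f, 'p, 'n) interp \<times> ('s \<Rightarrow> 'n)) ftr" where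
  "eval_functor \<sigma> C M E =
     \<lparr>On_ob = restrict (\<lambda>F. functor_interp \<sigma> F M) (Ob (FPFun C E)),
      On_ar = restrict (\<lambda>(F, G, \<tau>).
          (functor_interp \<sigma> F M, functor_interp \<sigma> G M, \<lambda>A\<in>Sorts \<sigma>. \<tau> (I_ob M [A])))
        (Ar (FPFun C E))\<rparr>"

text \<open>HOL cannot quantify over all types within a formula. The type \<open>'u\<close> therefore plays the role
  of the universe in which all categories under consideration live: \<open>C\<close> has its objects and arrows
  in \<open>'u\<close>, and is free with respect to all finite product categories of this kind. If \<open>'u\<close> is
  infinite, finite tuples over \<open>'u\<close> can be coded in \<open>'u\<close>, so categories built from finitely many
  data of given ones (such as arrow categories) are again of this kind, up to isomorphism.\<close>

definition free_on :: "('s, 'f) signature \<Rightarrow> ('u, 'u) cat \<Rightarrow> ('s, 'f, 'u, 'u) interp \<Rightarrow> bool" where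
  "free_on \<sigma> C i \<longleftrightarrow> fp_category C \<and> is_interp \<sigma> C i \<and>
     (\<forall>E :: ('u, 'u) cat. fp_category E \<longrightarrow>
        iso_of_cats (FPFun C E) (Int_cat \<sigma> E) (eval_functor \<sigma> C i E))"

record ('o, 'm, 't) two_cat =
  Und :: "('o, 'm) cat"
  Cell :: "'t set"
  Src :: "'t \<Rightarrow> 'm"
  Tgt :: "'t \<Rightarrow> 'm"
  Id2 :: "'m \<Rightarrow> 't"
  VComp :: "'t \<Rightarrow> 't \<Rightarrow> 't"  (infixl "\<bullet>\<index>" 70)
  HComp :: "'t \<Rightarrow> 't \<Rightarrow> 't"  (infixl "\<star>\<index>" 70)

definition HOM :: "('o, 'm, 't) two_cat \<Rightarrow> 'o \<Rightarrow> 'o \<Rightarrow> ('m, 't) cat" where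
  "HOM D X Y =
     \<lparr>Ob = hom (Und D) X Y,
      Ar = {\<theta> \<in> Cell D. Src D \<theta> \<in> hom (Und D) X Y \<and> Tgt D \<theta> \<in> hom (Und D) X Y},
      Dom = Src D, Cod = Tgt D, Ide = Id2 D, Comp = VComp D\<rparr>"

locale two_category =
  fixes D :: "('o, 'm, 't) two_cat"
  assumes category_Und: "category (Und D)"
    and Cell_in: "\<theta> \<in> Cell D \<Longrightarrow> \<exists>X \<in> Ob (Und D). \<exists>Y \<in> Ob (Und D). \<theta> \<in> Ar (HOM D X Y)"
    and category_HOM: "X \<in> Ob (Und D) \<Longrightarrow> Y \<in> Ob (Und D) \<Longrightarrow> category (HOM D X Y)"
    and HComp_in: "\<theta> \<in> hom (HOM D X Y) f f' \<Longrightarrow> \<phi> \<in> hom (HOM D Y Z) g g'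
      \<Longrightarrow> \<phi> \<star>\<^bsub>D\<^esub> \<theta> \<in> hom (HOM D X Z) (g \<cdot>\<^bsub>Und D\<^esub> f) (g' \<cdot>\<^bsub>Und D\<^esub> f')"
    and HComp_assoc: "\<theta> \<in> Ar (HOM D W X) \<Longrightarrow> \<phi> \<in> Ar (HOM D X Y) \<Longrightarrow> \<psi> \<in> Ar (HOM D Y Z)
      \<Longrightarrow> \<psi> \<star>\<^bsub>D\<^esub> \<phi> \<star>\<^bsub>D\<^esub> \<theta> = \<psi> \<star>\<^bsub>D\<^esub> (\<phi> \<star>\<^bsub>D\<^esub> \<theta>)"
    and HComp_Ide: "\<theta> \<in> Ar (HOM D X Y) \<Longrightarrow> \<theta> \<star>\<^bsub>D\<^esub> Id2 D (Ide (Und D) X) = \<theta>"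
    and Ide_HComp: "\<theta> \<in> Ar (HOM D X Y) \<Longrightarrow> Id2 D (Ide (Und D) Y) \<star>\<^bsub>D\<^esub> \<theta> = \<theta>"
    and HComp_Id2: "f \<in> hom (Und D) X Y \<Longrightarrow> g \<in> hom (Und D) Y Z
      \<Longrightarrow> Id2 D g \<star>\<^bsub>D\<^esub> Id2 D f = Id2 D (g \<cdot>\<^bsub>Und D\<^esub> f)"
    and interchange: "\<theta> \<in> hom (HOM D X Y) f f' \<Longrightarrow> \<theta>' \<in> hom (HOM D X Y) f' f''
      \<Longrightarrow> \<phi> \<in> hom (HOM D Y Z) g g' \<Longrightarrow> \<phi>' \<in> hom (HOM D Y Z) g' g''
      \<Longrightarrow> (\<phi>' \<bullet>\<^bsub>D\<^esub> \<phi>) \<star>\<^bsub>D\<^esub> (\<theta>' \<bullet>\<^bsub>D\<^esub> \<theta>) = (\<phi>' \<star>\<^bsub>D\<^esub> \<theta>') \<bullet>\<^bsub>D\<^esub> (\<phi> \<star>\<^bsub>D\<^esub> \<theta>)"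

definition Prod_cat :: "('o, 'm) cat list \<Rightarrow> ('o list, 'm list) cat" where
  "Prod_cat Cs =
     \<lparr>Ob = {xs. list_all2 (\<lambda>x A. x \<in> Ob A) xs Cs},
      Ar = {fs. list_all2 (\<lambda>f A. f \<in> Ar A) fs Cs},
      Dom = (\<lambda>fs. map2 Dom Cs fs),
      Cod = (\<lambda>fs. map2 Cod Cs fs),
      Ide = (\<lambda>xs. map2 Ide Cs xs),
      Comp = (\<lambda>gs fs. map (\<lambda>(A, g, f). g \<cdot>\<^bsub>A\<^esub> f) (zip Cs (zip gs fs)))\<rparr>"

text \<open>The functor in the second conjunct is the one induced by the projections; on 2-cells it is
  whiskering with the projections.\<close>

definition is_2product :: "('o, 'm, 't) two_cat \<Rightarrow> 'o \<Rightarrow> 'o list \<Rightarrow> 'm list \<Rightarrow> bool" where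
  "is_2product D P As ps \<longleftrightarrow> is_product (Und D) P As ps \<and>
     (\<forall>X \<in> Ob (Und D). iso_of_cats (HOM D X P) (Prod_cat (map (HOM D X) As))
        \<lparr>On_ob = (\<lambda>f \<in> Ob (HOM D X P). map (\<lambda>p. p \<cdot>\<^bsub>Und D\<^esub> f) ps),
         On_ar = (\<lambda>\<theta> \<in> Ar (HOM D X P). map (\<lambda>p. Id2 D p \<star>\<^bsub>D\<^esub> \<theta>) ps)\<rparr>)"

definition has_finite_2products :: "('o, 'm, 't) two_cat \<Rightarrow> bool" where
  "has_finite_2products D \<longleftrightarrow> (\<forall>As. set As \<subseteq> Ob (Und D) \<longrightarrow> (\<exists>P ps. is_2product D P As ps))"

definition is_equivalence :: "('o, 'm, 't) two_cat \<Rightarrow> 'o \<Rightarrow> 'o \<Rightarrow> 'm \<Rightarrow> bool" where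
  "is_equivalence D X Y f \<longleftrightarrow> f \<in> hom (Und D) X Y \<and>
     (\<exists>g \<in> hom (Und D) Y X.
        isos (HOM D X X) (g \<cdot>\<^bsub>Und D\<^esub> f) (Ide (Und D) X) \<noteq> {} \<and>
        isos (HOM D Y Y) (f \<cdot>\<^bsub>Und D\<^esub> g) (Ide (Und D) Y) \<noteq> {})"

definition homotopy_hom :: "('s, 'f) signature \<Rightarrow> ('o, 'm, 't) two_cat \<Rightarrow>
    ('s, 'f, 'o, 'm) interp \<Rightarrow> ('s, 'f, 'o, 'm) interp \<Rightarrow>
    ('s \<Rightarrow> 'm) \<Rightarrow> ('s list \<times> 's \<times> 'f \<Rightarrow> 't) \<Rightarrow> bool" where
  "homotopy_hom \<sigma> D M N \<alpha> \<alpha>\<^sub>2 \<longleftrightarrow>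
     (\<forall>A \<in> Sorts \<sigma>. \<alpha> A \<in> hom (Und D) (I_ob M [A]) (I_ob N [A])) \<and>
     (\<forall>(As, B, f) \<in> Ops \<sigma>. \<alpha>\<^sub>2 (As, B, f) \<in> isos (HOM D (I_ob M As) (I_ob N [B]))
        (\<alpha> B \<cdot>\<^bsub>Und D\<^esub> I_op M (As, B, f))
        (I_op N (As, B, f) \<cdot>\<^bsub>Und D\<^esub> prod_map (Und D) M N \<alpha> As))"

definition homotopy_equivalent :: "('s, 'f) signature \<Rightarrow> ('o, 'm, 't) two_cat \<Rightarrow>
    ('s, 'f, 'o, 'm) interp \<Rightarrow> ('s, 'f, 'o, 'm) interp \<Rightarrow> bool" where
  "homotopy_equivalent \<sigma> D M N \<longleftrightarrow>
     (\<exists>\<alpha> \<alpha>\<^sub>2. homotopy_hom \<sigma> D M N \<alpha> \<alpha>\<^sub>2 \<and>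
        (\<forall>A \<in> Sorts \<sigma>. is_equivalence D (I_ob M [A]) (I_ob N [A]) (\<alpha> A)))"

definition pseudonat_trans :: "('a, 'b) cat \<Rightarrow> ('o, 'm, 't) two_cat \<Rightarrow> ('a, 'b, 'o, 'm) ftr \<Rightarrow>
    ('a, 'b, 'o, 'm) ftr \<Rightarrow> ('a \<Rightarrow> 'm) \<Rightarrow> ('b \<Rightarrow> 't) \<Rightarrow> bool" where
  "pseudonat_trans C D F G \<beta> \<beta>\<^sub>2 \<longleftrightarrow>
     is_functor C (Und D) F \<and> is_functor C (Und D) G \<and>
     (\<forall>X \<in> Ob C. \<beta> X \<in> hom (Und D) (On_ob F X) (On_ob G X)) \<and>
     (\<forall>X Y. \<forall>f \<in> hom C X Y. \<beta>\<^sub>2 f \<in> isos (HOM D (On_ob F X) (On_ob G Y))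
        (\<beta> Y \<cdot>\<^bsub>Und D\<^esub> On_ar F f) (On_ar G f \<cdot>\<^bsub>Und D\<^esub> \<beta> X)) \<and>
     (\<forall>X Y Z. \<forall>f \<in> hom C X Y. \<forall>g \<in> hom C Y Z.
        (Id2 D (On_ar G g) \<star>\<^bsub>D\<^esub> \<beta>\<^sub>2 f) \<bullet>\<^bsub>D\<^esub> (\<beta>\<^sub>2 g \<star>\<^bsub>D\<^esub> Id2 D (On_ar F f)) = \<beta>\<^sub>2 (g \<cdot>\<^bsub>C\<^esub> f)) \<and>
     (\<forall>X \<in> Ob C. \<beta>\<^sub>2 (Ide C X) = Id2 D (\<beta> X))"

definition pseudonat_equivalent :: "('a, 'b) cat \<Rightarrow> ('o, 'm, 't) two_cat \<Rightarrow>
    ('a, 'b, 'o, 'm) ftr \<Rightarrow> ('a, 'b, 'o, 'm) ftr \<Rightarrow> bool" where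
  "pseudonat_equivalent C D F G \<longleftrightarrow>
     (\<exists>\<beta> \<beta>\<^sub>2. pseudonat_trans C D F G \<beta> \<beta>\<^sub>2 \<and>
        (\<forall>X \<in> Ob C. is_equivalence D (On_ob F X) (On_ob G X) (\<beta> X)))"

end

theory Submission
  imports Defs
begin

text \<open>
  Let \<open>Sq\<close> be the category whose objects are the equivalences of \<open>D\<close> and whose arrows are the squares
  that commute up to a chosen invertible 2-cell. Since the 1-dimensional products of \<open>D\<close> are
  2-products, a product of equivalences is an equivalence and, together with strictly commuting
  projection squares, a product in \<open>Sq\<close>; hence \<open>Sq\<close> is a finite product category, and taking
  domains or codomains preserves products. A homotopy equivalence from \<open>M\<close> to \<open>N\<close> is an
  interpretation in \<open>Sq\<close> lying over \<open>M\<close> and \<open>N\<close>. By freeness it extends to a functor \<open>C \<rightarrow> Sq\<close>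
  lying over \<open>Mt\<close> and \<open>Nt\<close>, and functoriality of the 2-cell components is precisely
  pseudonaturality. Conversely, a pseudonatural equivalence restricts along \<open>i\<close>; its component at a
  product need not be the product of components, but the 2-cells at the projections lift to an
  invertible 2-cell between the two, and pasting with it gives a homotopy equivalence.
\<close>

section \<open>Categories with products\<close>

lemma homD: "f \<in> hom C X Y \<Longrightarrow> f \<in> Ar C" "f \<in> hom C X Y \<Longrightarrow> Dom C f = X" "f \<in> hom C X Y \<Longrightarrow> Cod C f = Y"
  by (auto simp: hom_def)

context category
begin

lemma hom_ob: "f \<in> hom C X Y \<Longrightarrow> X \<in> Ob C" "f \<in> hom C X Y \<Longrightarrow> Y \<in> Ob C"
  using Dom_in Cod_in by (auto simp: hom_def)

lemma isosI:
  "f \<in> hom C X Y \<Longrightarrow> g \<in> hom C Y X \<Longrightarrow> g \<cdot>\<^bsub>C\<^esub> f = Ide C X \<Longrightarrow> f \<cdot>\<^bsub>C\<^esub> g = Ide C Y \<Longrightarrow> f \<in> isos C X Y"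
  by (auto simp: isos_def)

lemma isosE:
  assumes "f \<in> isos C X Y"
  obtains g where "f \<in> hom C X Y" "g \<in> hom C Y X" "g \<cdot>\<^bsub>C\<^esub> f = Ide C X" "f \<cdot>\<^bsub>C\<^esub> g = Ide C Y"
  using assms by (auto simp: isos_def)

lemma isos_Ide: "X \<in> Ob C \<Longrightarrow> Ide C X \<in> isos C X X"
  using Ide_in Comp_Ide by (auto simp: isos_def)

text \<open>Both inverse laws in \<open>isos_Comp\<close> are instances of this cancellation, with
  the roles of arrows and inverses exchanged.\<close>

lemma Comp_cancel_mid:
  assumes "f \<in> hom C W X" "g \<in> hom C X Y" "g' \<in> hom C Y X" "h \<in> hom C X Z" "g' \<cdot>\<^bsub>C\<^esub> g = Ide C X"
  shows "(h \<cdot>\<^bsub>C\<^esub> g') \<cdot>\<^bsub>C\<^esub> (g \<cdot>\<^bsub>C\<^esub> f) = h \<cdot>\<^bsub>C\<^esub> f"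
proof -
  have "(h \<cdot>\<^bsub>C\<^esub> g') \<cdot>\<^bsub>C\<^esub> (g \<cdot>\<^bsub>C\<^esub> f) = h \<cdot>\<^bsub>C\<^esub> (g' \<cdot>\<^bsub>C\<^esub> (g \<cdot>\<^bsub>C\<^esub> f))"
    using Comp_assoc[OF Comp_in[OF assms(1,2)] assms(3,4)] .
  also have "g' \<cdot>\<^bsub>C\<^esub> (g \<cdot>\<^bsub>C\<^esub> f) = f"
    using Comp_assoc[OF assms(1,2,3)] assms(5) Ide_Comp[OF assms(1)] by simp
  finally show ?thesis .
qed

lemma isos_Comp:
  assumes "f \<in> isos C X Y" "g \<in> isos C Y Z"
  shows "g \<cdot>\<^bsub>C\<^esub> f \<in> isos C X Z"
proof -
  obtain f' where f: "f \<in> hom C X Y" "f' \<in> hom C Y X" "f' \<cdot>\<^bsub>C\<^esub> f = Ide C X" "f \<cdot>\<^bsub>C\<^esub> f' = Ide C Y"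
    using assms(1) by (rule isosE)
  obtain g' where g: "g \<in> hom C Y Z" "g' \<in> hom C Z Y" "g' \<cdot>\<^bsub>C\<^esub> g = Ide C Y" "g \<cdot>\<^bsub>C\<^esub> g' = Ide C Z"
    using assms(2) by (rule isosE)
  show ?thesis
  proof (rule isosI)
    show "g \<cdot>\<^bsub>C\<^esub> f \<in> hom C X Z" "f' \<cdot>\<^bsub>C\<^esub> g' \<in> hom C Z X" using Comp_in f g by blast+
    show "(f' \<cdot>\<^bsub>C\<^esub> g') \<cdot>\<^bsub>C\<^esub> (g \<cdot>\<^bsub>C\<^esub> f) = Ide C X" using Comp_cancel_mid[OF f(1) g(1,2) f(2) g(3)] f by simp
    show "(g \<cdot>\<^bsub>C\<^esub> f) \<cdot>\<^bsub>C\<^esub> (f' \<cdot>\<^bsub>C\<^esub> g') = Ide C Z" using Comp_cancel_mid[OF g(2) f(2,1) g(1) f(4)] g by simp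
  qed
qed

end

section \<open>Finite products, with cones indexed by list positions\<close>

lemma cone_iff:
  "cone C X As fs \<longleftrightarrow> X \<in> Ob C \<and> length fs = length As \<and> (\<forall>k<length As. fs ! k \<in> hom C X (As ! k))"
  by (auto simp: cone_def list_all2_conv_all_nth)

lemma is_productD:
  assumes "is_product C P As ps"
  shows "P \<in> Ob C" "length ps = length As" "\<And>k. k < length As \<Longrightarrow> ps ! k \<in> hom C P (As ! k)"
  using assms by (auto simp: is_product_def cone_iff)

lemma product_lift:
  assumes "is_product C P As ps" "X \<in> Ob C" "\<And>k. k < length As \<Longrightarrow> f k \<in> hom C X (As ! k)"
  obtains h where "h \<in> hom C X P" "\<And>k. k < length As \<Longrightarrow> ps ! k \<cdot>\<^bsub>C\<^esub> h = f k"
proof -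
  have "cone C X As (map f [0..<length As])"
    using assms by (auto simp: cone_iff)
  then obtain h where h: "h \<in> hom C X P" "map (\<lambda>p. p \<cdot>\<^bsub>C\<^esub> h) ps = map f [0..<length As]"
    using assms(1) unfolding is_product_def by blast
  have "ps ! k \<cdot>\<^bsub>C\<^esub> h = f k" if "k < length As" for k
    using arg_cong[OF h(2), of "\<lambda>xs. xs ! k"] that is_productD(2)[OF assms(1)] by simp
  then show ?thesis using h that by blast
qed

text \<open>The projections of \<open>h\<close> form a cone through which both \<open>g\<close> and
  \<open>h\<close> factor, so the uniqueness clause applies.\<close>

lemma (in category) product_eqI:
  assumes P: "is_product C P As ps" and g: "g \<in> hom C X P" and h: "h \<in> hom C X P"
    and eq: "\<And>k. k < length As \<Longrightarrow> ps ! k \<cdot>\<^bsub>C\<^esub> g = ps ! k \<cdot>\<^bsub>C\<^esub> h"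
  shows "g = h"
proof -
  note D = is_productD[OF P]
  have "cone C X As (map (\<lambda>p. p \<cdot>\<^bsub>C\<^esub> h) ps)"
    using hom_ob(1)[OF h] Comp_in[OF h D(3)] D(2) by (auto simp: cone_iff)
  then have "\<exists>!k. k \<in> hom C X P \<and> map (\<lambda>p. p \<cdot>\<^bsub>C\<^esub> k) ps = map (\<lambda>p. p \<cdot>\<^bsub>C\<^esub> h) ps"
    using P unfolding is_product_def by blast
  moreover have "map (\<lambda>p. p \<cdot>\<^bsub>C\<^esub> g) ps = map (\<lambda>p. p \<cdot>\<^bsub>C\<^esub> h) ps"
    using eq D(2) by (intro nth_equalityI) simp_all
  ultimately show ?thesis using g h by blast
qed

lemma is_productI:
  assumes "P \<in> Ob C" and len: "length ps = length As" and "\<And>k. k < length As \<Longrightarrow> ps ! k \<in> hom C P (As ! k)"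
    and ex: "\<And>X f. X \<in> Ob C \<Longrightarrow> (\<And>k. k < length As \<Longrightarrow> f k \<in> hom C X (As ! k)) \<Longrightarrow>
        \<exists>h \<in> hom C X P. \<forall>k < length As. ps ! k \<cdot>\<^bsub>C\<^esub> h = f k"
    and uniq: "\<And>X g h. g \<in> hom C X P \<Longrightarrow> h \<in> hom C X P \<Longrightarrow>
        (\<And>k. k < length As \<Longrightarrow> ps ! k \<cdot>\<^bsub>C\<^esub> g = ps ! k \<cdot>\<^bsub>C\<^esub> h) \<Longrightarrow> g = h"
  shows "is_product C P As ps"
  unfolding is_product_def
proof (intro conjI allI impI)
  show "cone C P As ps" using assms by (simp add: cone_iff)
next
  fix X fs assume "cone C X As fs"
  then have fs: "X \<in> Ob C" "length fs = length As" "\<And>k. k < length As \<Longrightarrow> fs ! k \<in> hom C X (As ! k)"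
    by (auto simp: cone_iff)
  then obtain h where h: "h \<in> hom C X P" "\<forall>k < length As. ps ! k \<cdot>\<^bsub>C\<^esub> h = fs ! k"
    using ex[of X "\<lambda>k. fs ! k"] by blast
  show "\<exists>!h. h \<in> hom C X P \<and> map (\<lambda>p. p \<cdot>\<^bsub>C\<^esub> h) ps = fs"
  proof (intro ex1I conjI)
    show "h \<in> hom C X P" "map (\<lambda>p. p \<cdot>\<^bsub>C\<^esub> h) ps = fs"
      using h fs len by (auto intro!: nth_equalityI)
    fix g assume g: "g \<in> hom C X P \<and> map (\<lambda>p. p \<cdot>\<^bsub>C\<^esub> g) ps = fs"
    have "ps ! k \<cdot>\<^bsub>C\<^esub> g = fs ! k" if "k < length As" for k
      using g that len by auto
    then show "g = h" using uniq g h by auto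
  qed
qed

context category
begin

text \<open>Each vertex carries a cone over the other. The round trips agree with the identities
  after every projection, hence are identities. Compatibility with the projections is kept in the
  conclusion, since it is what carries further structure from one product to the other.\<close>

lemma product_comparison:
  assumes P: "is_product C P As ps" and Q: "is_product C Q As qs"
  obtains u v where "u \<in> hom C P Q" "v \<in> hom C Q P" "v \<cdot>\<^bsub>C\<^esub> u = Ide C P" "u \<cdot>\<^bsub>C\<^esub> v = Ide C Q"
    "\<And>k. k < length As \<Longrightarrow> qs ! k \<cdot>\<^bsub>C\<^esub> u = ps ! k" "\<And>k. k < length As \<Longrightarrow> ps ! k \<cdot>\<^bsub>C\<^esub> v = qs ! k"
proof -
  note p = is_productD[OF P] and q = is_productD[OF Q]
  obtain u where u: "u \<in> hom C P Q" "\<And>k. k < length As \<Longrightarrow> qs ! k \<cdot>\<^bsub>C\<^esub> u = ps ! k"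
    using product_lift[OF Q p(1), of "\<lambda>k. ps ! k"] p(3) by auto
  obtain v where v: "v \<in> hom C Q P" "\<And>k. k < length As \<Longrightarrow> ps ! k \<cdot>\<^bsub>C\<^esub> v = qs ! k"
    using product_lift[OF P q(1), of "\<lambda>k. qs ! k"] q(3) by auto
  have "v \<cdot>\<^bsub>C\<^esub> u = Ide C P"
  proof (rule product_eqI[OF P Comp_in[OF u(1) v(1)] Ide_in[OF p(1)]])
    fix k assume k: "k < length As"
    show "ps ! k \<cdot>\<^bsub>C\<^esub> (v \<cdot>\<^bsub>C\<^esub> u) = ps ! k \<cdot>\<^bsub>C\<^esub> Ide C P"
      using Comp_assoc[OF u(1) v(1) p(3)[OF k]] u v k Comp_Ide[OF p(3)[OF k]] by simp
  qed
  moreover have "u \<cdot>\<^bsub>C\<^esub> v = Ide C Q"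
  proof (rule product_eqI[OF Q Comp_in[OF v(1) u(1)] Ide_in[OF q(1)]])
    fix k assume k: "k < length As"
    show "qs ! k \<cdot>\<^bsub>C\<^esub> (u \<cdot>\<^bsub>C\<^esub> v) = qs ! k \<cdot>\<^bsub>C\<^esub> Ide C Q"
      using Comp_assoc[OF v(1) u(1) q(3)[OF k]] u v k Comp_Ide[OF q(3)[OF k]] by simp
  qed
  ultimately show ?thesis using that u v by blast
qed

text \<open>A cone factors through \<open>Q\<close> and is brought back by the inverse of
  \<open>u\<close>; uniqueness follows because an isomorphism can be cancelled on the left.\<close>

lemma product_transport:
  assumes Q: "is_product C Q As qs" and u: "u \<in> isos C P Q"
    and len: "length ps = length As" and ps: "\<And>k. k < length As \<Longrightarrow> ps ! k = qs ! k \<cdot>\<^bsub>C\<^esub> u"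
  shows "is_product C P As ps"
proof -
  note q = is_productD[OF Q]
  obtain v where v: "u \<in> hom C P Q" "v \<in> hom C Q P" "v \<cdot>\<^bsub>C\<^esub> u = Ide C P" "u \<cdot>\<^bsub>C\<^esub> v = Ide C Q"
    using u by (rule isosE)
  have psu: "ps ! k \<cdot>\<^bsub>C\<^esub> h = qs ! k \<cdot>\<^bsub>C\<^esub> (u \<cdot>\<^bsub>C\<^esub> h)" if "k < length As" "h \<in> hom C X P" for k h X
    using that ps Comp_assoc[OF that(2) v(1) q(3)] by simp
  show ?thesis
  proof (rule is_productI)
    show "P \<in> Ob C" using hom_ob v by blast
    show "ps ! k \<in> hom C P (As ! k)" if "k < length As" for k using Comp_in[OF v(1) q(3)] ps that by simp
  next
    fix X f assume X: "X \<in> Ob C" and f: "\<And>k. k < length As \<Longrightarrow> f k \<in> hom C X (As ! k)"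
    obtain h where h: "h \<in> hom C X Q" "\<And>k. k < length As \<Longrightarrow> qs ! k \<cdot>\<^bsub>C\<^esub> h = f k"
      using product_lift[OF Q X f] by blast
    have "u \<cdot>\<^bsub>C\<^esub> (v \<cdot>\<^bsub>C\<^esub> h) = h" using Comp_assoc[OF h(1) v(2) v(1)] v(4) Ide_Comp[OF h(1)] by simp
    then show "\<exists>h \<in> hom C X P. \<forall>k < length As. ps ! k \<cdot>\<^bsub>C\<^esub> h = f k"
      using h psu Comp_in[OF h(1) v(2)] by (intro bexI[of _ "v \<cdot>\<^bsub>C\<^esub> h"]) auto
  next
    fix X g h assume gh: "g \<in> hom C X P" "h \<in> hom C X P" and "\<And>k. k < length As \<Longrightarrow> ps ! k \<cdot>\<^bsub>C\<^esub> g = ps ! k \<cdot>\<^bsub>C\<^esub> h"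
    then have "u \<cdot>\<^bsub>C\<^esub> g = u \<cdot>\<^bsub>C\<^esub> h"
      using psu by (intro product_eqI[OF Q Comp_in[OF gh(1) v(1)] Comp_in[OF gh(2) v(1)]]) auto
    then have "v \<cdot>\<^bsub>C\<^esub> (u \<cdot>\<^bsub>C\<^esub> g) = v \<cdot>\<^bsub>C\<^esub> (u \<cdot>\<^bsub>C\<^esub> h)" by simp
    then show "g = h"
      using Comp_assoc[OF gh(1) v(1) v(2)] Comp_assoc[OF gh(2) v(1) v(2)] v(3) Ide_Comp gh by simp
  qed (fact len)
qed

end

section \<open>Functors that preserve products\<close>

lemma is_functorD:
  assumes "is_functor A B F"
  shows "category A" "category B" "X \<in> Ob A \<Longrightarrow> On_ob F X \<in> Ob B"
    "f \<in> hom A X Y \<Longrightarrow> On_ar F f \<in> hom B (On_ob F X) (On_ob F Y)"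
    "X \<in> Ob A \<Longrightarrow> On_ar F (Ide A X) = Ide B (On_ob F X)"
    "f \<in> hom A X Y \<Longrightarrow> g \<in> hom A Y Z \<Longrightarrow> On_ar F (g \<cdot>\<^bsub>A\<^esub> f) = On_ar F g \<cdot>\<^bsub>B\<^esub> On_ar F f"
  using assms unfolding is_functor_def by blast+

text \<open>Any two products of the same list are isomorphic compatibly with the projections, and
  functors preserve isomorphisms. Hence preservation need only be checked on one product of each
  list, for instance on an explicitly constructed one.\<close>

lemma fp_functorI:
  assumes F: "is_functor A B F"
    and ex: "\<And>As. set As \<subseteq> Ob A \<Longrightarrow>
      \<exists>P ps. is_product A P As ps \<and> is_product B (On_ob F P) (map (On_ob F) As) (map (On_ar F) ps)"
  shows "fp_functor A B F"
  unfolding fp_functor_def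
proof (intro conjI allI impI)
  fix Q As qs assume Q: "is_product A Q As qs"
  interpret A: category A using is_functorD(1)[OF F] .
  interpret B: category B using is_functorD(2)[OF F] .
  note q = is_productD[OF Q]
  have "set As \<subseteq> Ob A" using q(3) A.hom_ob(2) by (metis in_set_conv_nth subsetI)
  then obtain P ps where P: "is_product A P As ps"
    and FP: "is_product B (On_ob F P) (map (On_ob F) As) (map (On_ar F) ps)" using ex by blast
  note p = is_productD[OF P]
  obtain u v where u: "u \<in> hom A Q P" "v \<in> hom A P Q" "v \<cdot>\<^bsub>A\<^esub> u = Ide A Q" "u \<cdot>\<^bsub>A\<^esub> v = Ide A P"
    "\<And>k. k < length As \<Longrightarrow> ps ! k \<cdot>\<^bsub>A\<^esub> u = qs ! k"
    using A.product_comparison[OF Q P] by metis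
  have "On_ar F u \<in> isos B (On_ob F Q) (On_ob F P)"
  proof (rule B.isosI)
    show "On_ar F u \<in> hom B (On_ob F Q) (On_ob F P)" "On_ar F v \<in> hom B (On_ob F P) (On_ob F Q)"
      using is_functorD(4)[OF F] u by auto
    show "On_ar F v \<cdot>\<^bsub>B\<^esub> On_ar F u = Ide B (On_ob F Q)" "On_ar F u \<cdot>\<^bsub>B\<^esub> On_ar F v = Ide B (On_ob F P)"
      using is_functorD(6)[OF F u(1,2)] is_functorD(6)[OF F u(2,1)] u(3,4) is_functorD(5)[OF F] p(1) q(1) by auto
  qed
  then show "is_product B (On_ob F Q) (map (On_ob F) As) (map (On_ar F) qs)"
    by (rule B.product_transport[OF FP])
      (use p q u(5) is_functorD(6)[OF F u(1) p(3)] in auto)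
qed (fact F)

lemma is_functor_comp:
  assumes F: "is_functor A B F" and G: "is_functor B C G"
  shows "is_functor A C (comp_functor A G F)"
proof -
  interpret A: category A using is_functorD(1)[OF F] .
  have ob: "On_ob (comp_functor A G F) X = On_ob G (On_ob F X)" if "X \<in> Ob A" for X
    using that by (simp add: comp_functor_def compose_def)
  have ar: "On_ar (comp_functor A G F) f = On_ar G (On_ar F f)" if "f \<in> hom A X Y" for f X Y
    using that by (simp add: comp_functor_def compose_def hom_def)
  show ?thesis
    unfolding is_functor_def
  proof (intro conjI allI ballI)
    show "category A" "category C" using is_functorD F G by blast+
    show "On_ob (comp_functor A G F) \<in> Ob A \<rightarrow>\<^sub>E Ob C"
      using is_functorD(3)[OF F] is_functorD(3)[OF G] by (auto simp: comp_functor_def compose_def)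
    show "On_ar (comp_functor A G F) \<in> extensional (Ar A)"
      by (simp add: comp_functor_def compose_def)
  next
    fix X Y f assume "f \<in> hom A X Y"
    then show "On_ar (comp_functor A G F) f \<in> hom C (On_ob (comp_functor A G F) X) (On_ob (comp_functor A G F) Y)"
      using is_functorD(4)[OF F] is_functorD(4)[OF G] A.hom_ob[of f X Y] ob ar by simp
  next
    fix X assume "X \<in> Ob A"
    then show "On_ar (comp_functor A G F) (Ide A X) = Ide C (On_ob (comp_functor A G F) X)"
      using ob ar[OF A.Ide_in] is_functorD(3,5)[OF F] is_functorD(5)[OF G] by simp
  next
    fix X Y Z f g assume fg: "f \<in> hom A X Y" "g \<in> hom A Y Z"
    show "On_ar (comp_functor A G F) (g \<cdot>\<^bsub>A\<^esub> f)
        = On_ar (comp_functor A G F) g \<cdot>\<^bsub>C\<^esub> On_ar (comp_functor A G F) f"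
      by (simp only: ar[OF A.Comp_in[OF fg]] ar[OF fg(1)] ar[OF fg(2)] is_functorD(6)[OF F fg]
          is_functorD(6)[OF G is_functorD(4)[OF F fg(1)] is_functorD(4)[OF F fg(2)]])
  qed
qed

lemma fp_functor_comp:
  assumes F: "fp_functor A B F" and G: "fp_functor B C G"
  shows "fp_functor A C (comp_functor A G F)"
proof -
  have FF: "is_functor A B F" and GG: "is_functor B C G" using F G by (auto simp: fp_functor_def)
  interpret A: category A using is_functorD(1)[OF FF] .
  show ?thesis
    unfolding fp_functor_def
  proof (intro conjI allI impI)
    show "is_functor A C (comp_functor A G F)" by (rule is_functor_comp[OF FF GG])
    fix P As ps assume P: "is_product A P As ps"
    note p = is_productD[OF P]
    have "is_product C (On_ob G (On_ob F P)) (map (On_ob G) (map (On_ob F) As)) (map (On_ar G) (map (On_ar F) ps))"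
      using P F G unfolding fp_functor_def by blast
    moreover have "map (On_ob G) (map (On_ob F) As) = map (On_ob (comp_functor A G F)) As"
      using A.hom_ob(2)[OF p(3)] p(2)
      by (intro nth_equalityI) (simp_all add: comp_functor_def compose_def)
    moreover have "map (On_ar G) (map (On_ar F) ps) = map (On_ar (comp_functor A G F)) ps"
      using homD(1)[OF p(3)] p(2)
      by (intro nth_equalityI) (simp_all add: comp_functor_def compose_def)
    moreover have "On_ob (comp_functor A G F) P = On_ob G (On_ob F P)"
      using p(1) by (simp add: comp_functor_def compose_def)
    ultimately show "is_product C (On_ob (comp_functor A G F) P) (map (On_ob (comp_functor A G F)) As)
        (map (On_ar (comp_functor A G F)) ps)"
      by (simp only:)
  qed
qed

section \<open>Interpretations transported along functors, and freeness\<close>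

lemma functor_interp_comp:
  assumes E: "category E" and i: "is_interp \<sigma> E i"
  shows "functor_interp \<sigma> (comp_functor E G F) i = functor_interp \<sigma> G (functor_interp \<sigma> F i)"
proof -
  have P: "is_product E (I_ob i As) (map (\<lambda>A. I_ob i [A]) As) (I_pr i As)" if "As \<in> lists (Sorts \<sigma>)" for As
    using i that by (simp add: is_interp_def)
  \<comment> \<open>The composite functor is truncated to \<open>undefined\<close> outside
    \<open>E\<close>, so the equality depends on all objects, projections and operations of
    \<open>i\<close> lying in \<open>E\<close>.\<close>
  have ob: "I_ob i As \<in> Ob E" if "As \<in> lists (Sorts \<sigma>)" for As
    by (rule is_productD(1)[OF P[OF that]])
  have pr: "p \<in> Ar E" if "As \<in> lists (Sorts \<sigma>)" "p \<in> set (I_pr i As)" for As p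
    using is_productD(2,3)[OF P[OF that(1)]] that(2) by (auto simp: in_set_conv_nth hom_def)
  have op: "I_op i x \<in> Ar E" if "x \<in> Ops \<sigma>" for x
    using i that by (cases x) (auto simp: is_interp_def hom_def)
  show ?thesis
    using ob pr op
    by (intro interp.equality)
      (auto simp: functor_interp_def comp_functor_def compose_def intro!: restrict_ext)
qed

lemma functor_interp_eqI:
  assumes K: "is_interp \<sigma> E K"
    and ob: "\<And>As. As \<in> lists (Sorts \<sigma>) \<Longrightarrow> On_ob F (I_ob S As) = I_ob K As"
    and pr: "\<And>As. As \<in> lists (Sorts \<sigma>) \<Longrightarrow> map (On_ar F) (I_pr S As) = I_pr K As"
    and op: "\<And>x. x \<in> Ops \<sigma> \<Longrightarrow> On_ar F (I_op S x) = I_op K x"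
  shows "functor_interp \<sigma> F S = K"
proof (rule interp.equality)
  have ext: "I_ob K \<in> extensional (lists (Sorts \<sigma>))" "I_pr K \<in> extensional (lists (Sorts \<sigma>))"
    "I_op K \<in> extensional (Ops \<sigma>)"
    using K by (simp_all add: is_interp_def)
  show "I_ob (functor_interp \<sigma> F S) = I_ob K"
    by (rule extensionalityI[OF _ ext(1)]) (simp_all add: functor_interp_def ob)
  show "I_pr (functor_interp \<sigma> F S) = I_pr K"
    by (rule extensionalityI[OF _ ext(2)]) (simp_all add: functor_interp_def pr)
  show "I_op (functor_interp \<sigma> F S) = I_op K"
    by (rule extensionalityI[OF _ ext(3)]) (simp_all add: functor_interp_def op)
qed simp

lemma compose_eq_idD: "compose S g f = (\<lambda>x\<in>S. x) \<Longrightarrow> x \<in> S \<Longrightarrow> g (f x) = x"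
  by (drule fun_cong[of _ _ x]) (simp add: compose_def)

lemma iso_of_catsE:
  assumes "iso_of_cats A B F"
  obtains G where "is_functor A B F" "is_functor B A G"
    "\<And>X. X \<in> Ob A \<Longrightarrow> On_ob G (On_ob F X) = X" "\<And>Y. Y \<in> Ob B \<Longrightarrow> On_ob F (On_ob G Y) = Y"
    "\<And>f. f \<in> Ar A \<Longrightarrow> On_ar G (On_ar F f) = f" "\<And>g. g \<in> Ar B \<Longrightarrow> On_ar F (On_ar G g) = g"
proof -
  obtain G where G: "is_functor A B F" "is_functor B A G"
    "comp_functor A G F = id_functor A" "comp_functor B F G = id_functor B"
    using assms by (auto simp: iso_of_cats_def)
  have "compose (Ob A) (On_ob G) (On_ob F) = (\<lambda>X\<in>Ob A. X)" "compose (Ar A) (On_ar G) (On_ar F) = (\<lambda>X\<in>Ar A. X)"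
    "compose (Ob B) (On_ob F) (On_ob G) = (\<lambda>X\<in>Ob B. X)" "compose (Ar B) (On_ar F) (On_ar G) = (\<lambda>X\<in>Ar B. X)"
    using G(3,4) by (simp_all add: comp_functor_def id_functor_def)
  from this[THEN compose_eq_idD] show ?thesis using that[OF G(1,2)] by blast
qed

text \<open>Existence of extensions is surjectivity on objects of the isomorphism
  \<open>eval_functor\<close>; the extension is the image of \<open>A\<close> under the inverse
  functor.\<close>

lemma free_on_ex:
  fixes C E :: "('u, 'u) cat"
  assumes "free_on \<sigma> C i" "fp_category E" "is_interp \<sigma> E A"
  obtains F where "fp_functor C E F" "functor_interp \<sigma> F i = A"
proof -
  have "iso_of_cats (FPFun C E) (Int_cat \<sigma> E) (eval_functor \<sigma> C i E)"
    using assms by (simp add: free_on_def)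
  then obtain G where G: "is_functor (Int_cat \<sigma> E) (FPFun C E) G"
    "\<And>Y. Y \<in> Ob (Int_cat \<sigma> E) \<Longrightarrow> On_ob (eval_functor \<sigma> C i E) (On_ob G Y) = Y"
    by (rule iso_of_catsE) blast
  have "A \<in> Ob (Int_cat \<sigma> E)" using assms by (simp add: Int_cat_def)
  then have *: "On_ob G A \<in> Ob (FPFun C E)" "On_ob (eval_functor \<sigma> C i E) (On_ob G A) = A"
    by (rule is_functorD(3)[OF G(1)], rule G(2))
  show ?thesis
  proof (rule that)
    show "fp_functor C E (On_ob G A)" using *(1) by (simp add: FPFun_def)
    show "functor_interp \<sigma> (On_ob G A) i = A" using * by (simp add: eval_functor_def)
  qed
qed

text \<open>Uniqueness of extensions is injectivity on objects of
  \<open>eval_functor\<close>.\<close>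

lemma free_on_unique:
  fixes C E :: "('u, 'u) cat"
  assumes "free_on \<sigma> C i" "fp_category E" "fp_functor C E F" "fp_functor C E G"
    "functor_interp \<sigma> F i = functor_interp \<sigma> G i"
  shows "F = G"
proof -
  have "iso_of_cats (FPFun C E) (Int_cat \<sigma> E) (eval_functor \<sigma> C i E)"
    using assms by (simp add: free_on_def)
  then have "inj_on (On_ob (eval_functor \<sigma> C i E)) (Ob (FPFun C E))"
    by (rule iso_of_catsE) (rule inj_on_inverseI)
  moreover have "F \<in> Ob (FPFun C E)" "G \<in> Ob (FPFun C E)"
    "On_ob (eval_functor \<sigma> C i E) F = On_ob (eval_functor \<sigma> C i E) G"
    using assms(3-5) by (simp_all add: FPFun_def eval_functor_def)
  ultimately show ?thesis by (blast dest: inj_onD)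
qed

text \<open>The definite description in \<open>prod_map\<close> is justified here: composing the
  projections of \<open>M\<close> with the components of \<open>\<alpha>\<close> gives a cone over
  the product chosen by \<open>N\<close>, which has exactly one factorization.\<close>

lemma (in category) prod_map_props:
  assumes M: "is_product C (I_ob M As) (map (\<lambda>A. I_ob M [A]) As) (I_pr M As)"
    and N: "is_product C (I_ob N As) (map (\<lambda>A. I_ob N [A]) As) (I_pr N As)"
    and \<alpha>: "\<And>A. A \<in> set As \<Longrightarrow> \<alpha> A \<in> hom C (I_ob M [A]) (I_ob N [A])"
  shows "prod_map C M N \<alpha> As \<in> hom C (I_ob M As) (I_ob N As)"
    "k < length As \<Longrightarrow> I_pr N As ! k \<cdot>\<^bsub>C\<^esub> prod_map C M N \<alpha> As = \<alpha> (As ! k) \<cdot>\<^bsub>C\<^esub> I_pr M As ! k"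
proof -
  note m = is_productD[OF M, simplified] and n = is_productD[OF N, simplified]
  have "cone C (I_ob M As) (map (\<lambda>A. I_ob N [A]) As) (map2 (\<lambda>A p. \<alpha> A \<cdot>\<^bsub>C\<^esub> p) As (I_pr M As))"
    using m \<alpha> by (auto simp: cone_iff intro!: Comp_in)
  then have "\<exists>!h. h \<in> hom C (I_ob M As) (I_ob N As) \<and>
      map (\<lambda>p. p \<cdot>\<^bsub>C\<^esub> h) (I_pr N As) = map2 (\<lambda>A p. \<alpha> A \<cdot>\<^bsub>C\<^esub> p) As (I_pr M As)"
    using N unfolding is_product_def by blast
  from theI'[OF this, folded prod_map_def]
  have *: "prod_map C M N \<alpha> As \<in> hom C (I_ob M As) (I_ob N As)"
    "map (\<lambda>p. p \<cdot>\<^bsub>C\<^esub> prod_map C M N \<alpha> As) (I_pr N As) = map2 (\<lambda>A p. \<alpha> A \<cdot>\<^bsub>C\<^esub> p) As (I_pr M As)" by auto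
  show "prod_map C M N \<alpha> As \<in> hom C (I_ob M As) (I_ob N As)" by fact
  show "I_pr N As ! k \<cdot>\<^bsub>C\<^esub> prod_map C M N \<alpha> As = \<alpha> (As ! k) \<cdot>\<^bsub>C\<^esub> I_pr M As ! k" if "k < length As"
    using arg_cong[OF *(2), of "\<lambda>xs. xs ! k"] m(2) n(2) that by simp
qed

section \<open>Products in 2-categories\<close>

lemma HOM_simps [simp]:
  "Ob (HOM D X Y) = hom (Und D) X Y" "Dom (HOM D X Y) = Src D" "Cod (HOM D X Y) = Tgt D"
  "Ide (HOM D X Y) = Id2 D" "Comp (HOM D X Y) = VComp D"
  by (simp_all add: HOM_def)

section \<open>Hom-categories and the calculus of whiskering\<close>

context two_category
begin

abbreviation hcomp1 (infixl "\<odot>" 70) where "g \<odot> f \<equiv> g \<cdot>\<^bsub>Und D\<^esub> f"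
abbreviation vcomp2 (infixl "\<bullet>" 70) where "\<phi> \<bullet> \<theta> \<equiv> \<phi> \<bullet>\<^bsub>D\<^esub> \<theta>"
abbreviation "hom1 \<equiv> hom (Und D)"
abbreviation "hom2 X Y \<equiv> hom (HOM D X Y)"
abbreviation "isos2 X Y \<equiv> isos (HOM D X Y)"
abbreviation whiskl (infixr "\<rhd>" 75) where "g \<rhd> \<theta> \<equiv> Id2 D g \<star>\<^bsub>D\<^esub> \<theta>"
abbreviation whiskr (infixl "\<lhd>" 75) where "\<theta> \<lhd> f \<equiv> \<theta> \<star>\<^bsub>D\<^esub> Id2 D f"

sublocale U: category "Und D" by (rule category_Und)

lemma HOM_cat: "f \<in> hom1 X Y \<Longrightarrow> category (HOM D X Y)"
  using category_HOM U.hom_ob by blast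

lemma hom2_hom1:
  assumes "\<theta> \<in> hom2 X Y f g" shows "f \<in> hom1 X Y" "g \<in> hom1 X Y"
  using assms by (auto simp: hom_def HOM_def)

lemma hom2_Ar: "\<theta> \<in> hom2 X Y f g \<Longrightarrow> \<theta> \<in> Ar (HOM D X Y)"
  by (auto simp: hom_def)

lemma Id2_in: "f \<in> hom1 X Y \<Longrightarrow> Id2 D f \<in> hom2 X Y f f"
  using category.Ide_in[OF HOM_cat] by force

lemma VComp_in: "\<theta> \<in> hom2 X Y f g \<Longrightarrow> \<phi> \<in> hom2 X Y g h \<Longrightarrow> \<phi> \<bullet> \<theta> \<in> hom2 X Y f h"
  using category.Comp_in[OF HOM_cat[OF hom2_hom1(1)]] by force

lemma VComp_assoc:
  "\<theta> \<in> hom2 X Y f g \<Longrightarrow> \<phi> \<in> hom2 X Y g h \<Longrightarrow> \<psi> \<in> hom2 X Y h k \<Longrightarrow> \<psi> \<bullet> \<phi> \<bullet> \<theta> = \<psi> \<bullet> (\<phi> \<bullet> \<theta>)"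
  using category.Comp_assoc[OF HOM_cat[OF hom2_hom1(1)]] by force

lemma VComp_Id2: "\<theta> \<in> hom2 X Y f g \<Longrightarrow> \<theta> \<bullet> Id2 D f = \<theta>"
  using category.Comp_Ide[OF HOM_cat[OF hom2_hom1(1)]] by force

lemma Id2_VComp: "\<theta> \<in> hom2 X Y f g \<Longrightarrow> Id2 D g \<bullet> \<theta> = \<theta>"
  using category.Ide_Comp[OF HOM_cat[OF hom2_hom1(1)]] by force

lemma whiskl_in: "\<theta> \<in> hom2 X Y f f' \<Longrightarrow> g \<in> hom1 Y Z \<Longrightarrow> g \<rhd> \<theta> \<in> hom2 X Z (g \<odot> f) (g \<odot> f')"
  by (rule HComp_in[OF _ Id2_in])

lemma whiskr_in: "\<theta> \<in> hom2 Y Z g g' \<Longrightarrow> f \<in> hom1 X Y \<Longrightarrow> \<theta> \<lhd> f \<in> hom2 X Z (g \<odot> f) (g' \<odot> f)"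
  by (rule HComp_in[OF Id2_in])

lemma whiskl_whiskl:
  "\<theta> \<in> hom2 W X f f' \<Longrightarrow> g \<in> hom1 X Y \<Longrightarrow> h \<in> hom1 Y Z \<Longrightarrow> h \<rhd> g \<rhd> \<theta> = (h \<odot> g) \<rhd> \<theta>"
  using HComp_assoc[OF hom2_Ar hom2_Ar[OF Id2_in] hom2_Ar[OF Id2_in]] HComp_Id2 by metis

lemma whiskr_whiskr:
  "\<theta> \<in> hom2 Y Z h h' \<Longrightarrow> f \<in> hom1 W X \<Longrightarrow> g \<in> hom1 X Y \<Longrightarrow> \<theta> \<lhd> g \<lhd> f = \<theta> \<lhd> (g \<odot> f)"
  using HComp_assoc[OF hom2_Ar[OF Id2_in] hom2_Ar[OF Id2_in] hom2_Ar] HComp_Id2 by metis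

lemma whiskl_whiskr:
  "\<theta> \<in> hom2 X Y g g' \<Longrightarrow> f \<in> hom1 W X \<Longrightarrow> h \<in> hom1 Y Z \<Longrightarrow> (h \<rhd> \<theta>) \<lhd> f = h \<rhd> (\<theta> \<lhd> f)"
  using HComp_assoc[OF hom2_Ar[OF Id2_in] hom2_Ar hom2_Ar[OF Id2_in]] by metis

text \<open>This is interchange with both 2-cells on the left equal to \<open>Id2 D g\<close>, whose
  vertical composite with itself is again \<open>Id2 D g\<close>.\<close>

lemma whiskl_VComp:
  assumes "\<theta> \<in> hom2 X Y f f'" "\<phi> \<in> hom2 X Y f' f''" "g \<in> hom1 Y Z"
  shows "g \<rhd> (\<phi> \<bullet> \<theta>) = (g \<rhd> \<phi>) \<bullet> (g \<rhd> \<theta>)"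
  using interchange[OF assms(1,2) Id2_in[OF assms(3)] Id2_in[OF assms(3)]] VComp_Id2[OF Id2_in[OF assms(3)]] by simp

lemma whiskr_VComp:
  assumes "\<theta> \<in> hom2 Y Z g g'" "\<phi> \<in> hom2 Y Z g' g''" "f \<in> hom1 X Y"
  shows "(\<phi> \<bullet> \<theta>) \<lhd> f = (\<phi> \<lhd> f) \<bullet> (\<theta> \<lhd> f)"
  using interchange[OF Id2_in[OF assms(3)] Id2_in[OF assms(3)] assms(1,2)] VComp_Id2[OF Id2_in[OF assms(3)]] by simp

lemma whiskl_Ide: "\<theta> \<in> hom2 X Y f f' \<Longrightarrow> Ide (Und D) Y \<rhd> \<theta> = \<theta>"
  using Ide_HComp hom2_Ar by blast

lemma whiskr_Ide: "\<theta> \<in> hom2 X Y f f' \<Longrightarrow> \<theta> \<lhd> Ide (Und D) X = \<theta>"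
  using HComp_Ide hom2_Ar by blast

lemma isos2_hom2: "\<theta> \<in> isos2 X Y f g \<Longrightarrow> \<theta> \<in> hom2 X Y f g"
  by (simp add: isos_def)

lemma isos2I:
  "\<theta> \<in> hom2 X Y f g \<Longrightarrow> \<theta>' \<in> hom2 X Y g f \<Longrightarrow> \<theta>' \<bullet> \<theta> = Id2 D f \<Longrightarrow> \<theta> \<bullet> \<theta>' = Id2 D g \<Longrightarrow> \<theta> \<in> isos2 X Y f g"
  by (auto simp: isos_def)

lemma isos2E:
  assumes "\<theta> \<in> isos2 X Y f g"
  obtains \<theta>' where "\<theta> \<in> hom2 X Y f g" "\<theta>' \<in> hom2 X Y g f" "\<theta>' \<bullet> \<theta> = Id2 D f" "\<theta> \<bullet> \<theta>' = Id2 D g"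
  using assms by (auto simp: isos_def)

lemma isos2_inverse:
  assumes "\<theta> \<in> isos2 X Y f g"
  obtains \<theta>' where "\<theta>' \<in> isos2 X Y g f" "\<theta>' \<bullet> \<theta> = Id2 D f" "\<theta> \<bullet> \<theta>' = Id2 D g"
  using assms by (auto simp: isos_def)

lemma isos2_Id2: "f \<in> hom1 X Y \<Longrightarrow> Id2 D f \<in> isos2 X Y f f"
  using category.isos_Ide[OF HOM_cat] by force

lemma isos2_VComp: "\<theta> \<in> isos2 X Y f g \<Longrightarrow> \<phi> \<in> isos2 X Y g h \<Longrightarrow> \<phi> \<bullet> \<theta> \<in> isos2 X Y f h"
  using category.isos_Comp[OF HOM_cat[OF hom2_hom1(1)[OF isos2_hom2]]] by force

text \<open>Whiskering is functorial on hom-categories, so the whiskered inverse is an inverse of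
  the whiskered 2-cell.\<close>

lemma isos2_whiskl:
  assumes "\<theta> \<in> isos2 X Y f f'" and g: "g \<in> hom1 Y Z"
  shows "g \<rhd> \<theta> \<in> isos2 X Z (g \<odot> f) (g \<odot> f')"
proof -
  obtain \<theta>' where t: "\<theta> \<in> hom2 X Y f f'" "\<theta>' \<in> hom2 X Y f' f" "\<theta>' \<bullet> \<theta> = Id2 D f" "\<theta> \<bullet> \<theta>' = Id2 D f'"
    using assms(1) by (rule isos2E)
  have "(g \<rhd> \<theta>') \<bullet> (g \<rhd> \<theta>) = Id2 D (g \<odot> f)" "(g \<rhd> \<theta>) \<bullet> (g \<rhd> \<theta>') = Id2 D (g \<odot> f')"
    using whiskl_VComp[OF t(1,2) g] whiskl_VComp[OF t(2,1) g] t(3,4)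
      HComp_Id2[OF hom2_hom1(1)[OF t(1)] g] HComp_Id2[OF hom2_hom1(2)[OF t(1)] g] by simp_all
  then show ?thesis by (rule isos2I[OF whiskl_in[OF t(1) g] whiskl_in[OF t(2) g]])
qed

lemma isos2_whiskr:
  assumes "\<theta> \<in> isos2 Y Z g g'" and f: "f \<in> hom1 X Y"
  shows "\<theta> \<lhd> f \<in> isos2 X Z (g \<odot> f) (g' \<odot> f)"
proof -
  obtain \<theta>' where t: "\<theta> \<in> hom2 Y Z g g'" "\<theta>' \<in> hom2 Y Z g' g" "\<theta>' \<bullet> \<theta> = Id2 D g" "\<theta> \<bullet> \<theta>' = Id2 D g'"
    using assms(1) by (rule isos2E)
  have "(\<theta>' \<lhd> f) \<bullet> (\<theta> \<lhd> f) = Id2 D (g \<odot> f)" "(\<theta> \<lhd> f) \<bullet> (\<theta>' \<lhd> f) = Id2 D (g' \<odot> f)"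
    using whiskr_VComp[OF t(1,2) f] whiskr_VComp[OF t(2,1) f] t(3,4)
      HComp_Id2[OF f hom2_hom1(1)[OF t(1)]] HComp_Id2[OF f hom2_hom1(2)[OF t(1)]] by simp_all
  then show ?thesis by (rule isos2I[OF whiskr_in[OF t(1) f] whiskr_in[OF t(2) f]])
qed

end

section \<open>The two-dimensional universal property of products\<close>

locale fp_two_category = two_category D for D :: "('o, 'm, 't) two_cat" +
  assumes two_products: "has_finite_2products D"
begin

lemma fp_category_Und: "fp_category (Und D)"
  using two_products category_Und unfolding fp_category_def has_finite_2products_def is_2product_def by blast

text \<open>This is fullness of the functor induced by the projections: the tuple of the
  \<open>\<theta> k\<close> is an arrow of the product of hom-categories, and the inverse functor
  sends it to the required 2-cell.\<close>

lemma two_product_lift: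
  assumes P: "is_2product D P As ps" and f: "f \<in> hom1 X P" and g: "g \<in> hom1 X P"
    and \<theta>: "\<And>k. k < length As \<Longrightarrow> \<theta> k \<in> hom2 X (As ! k) (ps ! k \<odot> f) (ps ! k \<odot> g)"
  obtains \<phi> where "\<phi> \<in> hom2 X P f g" "\<And>k. k < length As \<Longrightarrow> ps ! k \<rhd> \<phi> = \<theta> k"
proof -
  define F where "F = \<lparr>On_ob = (\<lambda>f \<in> Ob (HOM D X P). map (\<lambda>p. p \<odot> f) ps),
         On_ar = (\<lambda>\<theta> \<in> Ar (HOM D X P). map (\<lambda>p. p \<rhd> \<theta>) ps)\<rparr>"
  define B where "B = Prod_cat (map (HOM D X) As)"
  have "is_product (Und D) P As ps" using P by (simp add: is_2product_def)
  note p = is_productD[OF this]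
  have "iso_of_cats (HOM D X P) B F"
    using P U.hom_ob[OF f] unfolding is_2product_def F_def B_def by blast
  then obtain G where F: "is_functor (HOM D X P) B F" and G: "is_functor B (HOM D X P) G"
    and GF: "\<And>Y. Y \<in> Ob (HOM D X P) \<Longrightarrow> On_ob G (On_ob F Y) = Y"
    and FG: "\<And>g. g \<in> Ar B \<Longrightarrow> On_ar F (On_ar G g) = g"
    by (rule iso_of_catsE) blast
  have Fob: "On_ob F h = map (\<lambda>p. p \<odot> h) ps" if "h \<in> hom1 X P" for h
    using that by (simp add: F_def)
  define t where "t = map \<theta> [0..<length As]"
  have t: "t \<in> hom B (On_ob F f) (On_ob F g)"
    unfolding hom_def Fob[OF f] Fob[OF g]
    using \<theta> p(2) by (auto simp: t_def B_def Prod_cat_def list_all2_conv_all_nth hom_def intro!: nth_equalityI)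
  \<comment> \<open>The inverse functor sends the endpoints \<open>On_ob F f\<close> and
    \<open>On_ob F g\<close> of \<open>t\<close> back to \<open>f\<close> and
    \<open>g\<close>.\<close>
  have in2: "On_ar G t \<in> hom2 X P f g"
    using is_functorD(4)[OF G t] GF f g by simp
  have "On_ar F (On_ar G t) = t" using FG homD(1)[OF t] .
  then have "map (\<lambda>p. p \<rhd> On_ar G t) ps = t"
    using hom2_Ar[OF in2] by (simp add: F_def)
  then have "ps ! k \<rhd> On_ar G t = \<theta> k" if "k < length As" for k
    using that p(2) by (auto simp: t_def dest: arg_cong[of _ _ "\<lambda>xs. xs ! k"])
  with in2 show ?thesis by (rule that)
qed

text \<open>This is faithfulness of the functor induced by the projections, since an isomorphism of
  categories is injective on arrows.\<close>

lemma two_product_eqI: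
  assumes P: "is_2product D P As ps" and \<theta>: "\<theta> \<in> hom2 X P f g" and \<phi>: "\<phi> \<in> hom2 X P f g"
    and eq: "\<And>k. k < length As \<Longrightarrow> ps ! k \<rhd> \<theta> = ps ! k \<rhd> \<phi>"
  shows "\<theta> = \<phi>"
proof -
  define F where "F = \<lparr>On_ob = (\<lambda>f \<in> Ob (HOM D X P). map (\<lambda>p. p \<odot> f) ps),
         On_ar = (\<lambda>\<theta> \<in> Ar (HOM D X P). map (\<lambda>p. p \<rhd> \<theta>) ps)\<rparr>"
  define B where "B = Prod_cat (map (HOM D X) As)"
  have "is_product (Und D) P As ps" using P by (simp add: is_2product_def)
  note p = is_productD[OF this]
  have "iso_of_cats (HOM D X P) B F"
    using P U.hom_ob[OF hom2_hom1(1)[OF \<theta>]] unfolding is_2product_def F_def B_def by blast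
  then have "inj_on (On_ar F) (Ar (HOM D X P))"
    by (rule iso_of_catsE) (rule inj_on_inverseI)
  moreover have "On_ar F \<theta> = On_ar F \<phi>"
    using eq p(2) hom2_Ar[OF \<theta>] hom2_Ar[OF \<phi>] unfolding F_def by (auto simp: list_eq_iff_nth_eq simp del: map_eq_conv)
  ultimately show ?thesis using hom2_Ar[OF \<theta>] hom2_Ar[OF \<phi>] by (blast dest: inj_onD)
qed

text \<open>The 2-dimensional universal property is only assumed for one product of each list; it passes
  to all others along the comparison isomorphisms.\<close>

lemma product_eqI2:
  assumes P: "is_product (Und D) P As ps" and \<theta>: "\<theta> \<in> hom2 X P f g" and \<phi>: "\<phi> \<in> hom2 X P f g"
    and eq: "\<And>k. k < length As \<Longrightarrow> ps ! k \<rhd> \<theta> = ps ! k \<rhd> \<phi>"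
  shows "\<theta> = \<phi>"
proof -
  note p = is_productD[OF P]
  have "set As \<subseteq> Ob (Und D)" using p(3) U.hom_ob(2) by (metis in_set_conv_nth subsetI)
  then obtain Q qs where Q: "is_2product D Q As qs"
    using two_products unfolding has_finite_2products_def by blast
  then have Q1: "is_product (Und D) Q As qs" by (simp add: is_2product_def)
  obtain u v where u: "u \<in> hom1 P Q" "v \<in> hom1 Q P" "v \<odot> u = Ide (Und D) P"
    "\<And>k. k < length As \<Longrightarrow> qs ! k \<odot> u = ps ! k"
    using U.product_comparison[OF P Q1] by metis
  have "u \<rhd> \<theta> = u \<rhd> \<phi>"
  proof (rule two_product_eqI[OF Q whiskl_in[OF \<theta> u(1)] whiskl_in[OF \<phi> u(1)]])
    fix k assume k: "k < length As"
    then show "qs ! k \<rhd> u \<rhd> \<theta> = qs ! k \<rhd> u \<rhd> \<phi>"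
      using whiskl_whiskl[OF \<theta> u(1) is_productD(3)[OF Q1 k]] whiskl_whiskl[OF \<phi> u(1) is_productD(3)[OF Q1 k]]
        eq[OF k] u(4)[OF k] by simp
  qed
  \<comment> \<open>As \<open>v \<odot> u\<close> is an identity, whiskering with \<open>v\<close>
    undoes whiskering with \<open>u\<close>.\<close>
  then have "v \<rhd> u \<rhd> \<theta> = v \<rhd> u \<rhd> \<phi>" by simp
  then show ?thesis
    using whiskl_whiskl[OF \<theta> u(1,2)] whiskl_whiskl[OF \<phi> u(1,2)] u(3) whiskl_Ide[OF \<theta>] whiskl_Ide[OF \<phi>] by simp
qed

lemma product_lift2:
  assumes P: "is_product (Und D) P As ps" and f: "f \<in> hom1 X P" and g: "g \<in> hom1 X P"
    and \<theta>: "\<And>k. k < length As \<Longrightarrow> \<theta> k \<in> hom2 X (As ! k) (ps ! k \<odot> f) (ps ! k \<odot> g)"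
  obtains \<phi> where "\<phi> \<in> hom2 X P f g" "\<And>k. k < length As \<Longrightarrow> ps ! k \<rhd> \<phi> = \<theta> k"
proof -
  note p = is_productD[OF P]
  have "set As \<subseteq> Ob (Und D)" using p(3) U.hom_ob(2) by (metis in_set_conv_nth subsetI)
  then obtain Q qs where Q: "is_2product D Q As qs"
    using two_products unfolding has_finite_2products_def by blast
  then have Q1: "is_product (Und D) Q As qs" by (simp add: is_2product_def)
  note q = is_productD[OF Q1]
  obtain u v where u: "u \<in> hom1 P Q" "v \<in> hom1 Q P" "v \<odot> u = Ide (Und D) P"
    "\<And>k. k < length As \<Longrightarrow> qs ! k \<odot> u = ps ! k" "\<And>k. k < length As \<Longrightarrow> ps ! k \<odot> v = qs ! k"
    using U.product_comparison[OF P Q1] by metis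
  have qu: "qs ! k \<odot> (u \<odot> h) = ps ! k \<odot> h" if "k < length As" "h \<in> hom1 X P" for k h
    using U.Comp_assoc[OF that(2) u(1) q(3)[OF that(1)]] u(4)[OF that(1)] by simp
  have vu: "v \<odot> (u \<odot> h) = h" if "h \<in> hom1 X P" for h
    using U.Comp_assoc[OF that(1) u(1,2)] u(3) U.Ide_Comp[OF that] by simp
  \<comment> \<open>The family has the same endpoints when read over \<open>Q\<close>, because
    \<open>qs ! k \<odot> u\<close> is \<open>ps ! k\<close>. So it lifts to \<open>Q\<close> first,
    and \<open>v\<close> then carries the lift back to \<open>P\<close>.\<close>
  obtain \<phi> where \<phi>: "\<phi> \<in> hom2 X Q (u \<odot> f) (u \<odot> g)" "\<And>k. k < length As \<Longrightarrow> qs ! k \<rhd> \<phi> = \<theta> k"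
    using two_product_lift[OF Q U.Comp_in[OF f u(1)] U.Comp_in[OF g u(1)], of \<theta>] \<theta> qu f g by auto
  show ?thesis
  proof
    show "v \<rhd> \<phi> \<in> hom2 X P f g" using whiskl_in[OF \<phi>(1) u(2)] vu f g by simp
    show "ps ! k \<rhd> v \<rhd> \<phi> = \<theta> k" if "k < length As" for k
      using whiskl_whiskl[OF \<phi>(1) u(2) p(3)[OF that]] u(5) \<phi>(2) that by simp
  qed
qed

text \<open>The inverses of the \<open>\<theta> k\<close> lift as well. Both composites of the two
  lifts project to identity 2-cells, so \<open>product_eqI2\<close> makes the lifts mutually
  inverse.\<close>

lemma product_lift2_iso:
  assumes P: "is_product (Und D) P As ps" and f: "f \<in> hom1 X P" and g: "g \<in> hom1 X P"
    and \<theta>: "\<And>k. k < length As \<Longrightarrow> \<theta> k \<in> isos2 X (As ! k) (ps ! k \<odot> f) (ps ! k \<odot> g)"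
  obtains \<phi> where "\<phi> \<in> isos2 X P f g" "\<And>k. k < length As \<Longrightarrow> ps ! k \<rhd> \<phi> = \<theta> k"
proof -
  note p = is_productD[OF P]
  have "\<forall>k. \<exists>t. k < length As \<longrightarrow> t \<in> hom2 X (As ! k) (ps ! k \<odot> g) (ps ! k \<odot> f) \<and>
      t \<bullet> \<theta> k = Id2 D (ps ! k \<odot> f) \<and> \<theta> k \<bullet> t = Id2 D (ps ! k \<odot> g)"
    using \<theta> isos2E by metis
  then obtain t where t: "\<And>k. k < length As \<Longrightarrow> t k \<in> hom2 X (As ! k) (ps ! k \<odot> g) (ps ! k \<odot> f)"
      "\<And>k. k < length As \<Longrightarrow> t k \<bullet> \<theta> k = Id2 D (ps ! k \<odot> f)"
      "\<And>k. k < length As \<Longrightarrow> \<theta> k \<bullet> t k = Id2 D (ps ! k \<odot> g)" unfolding choice_iff by blast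
  obtain \<phi> where \<phi>: "\<phi> \<in> hom2 X P f g" "\<And>k. k < length As \<Longrightarrow> ps ! k \<rhd> \<phi> = \<theta> k"
    using product_lift2[OF P f g isos2_hom2[OF \<theta>]] by blast
  obtain \<psi> where \<psi>: "\<psi> \<in> hom2 X P g f" "\<And>k. k < length As \<Longrightarrow> ps ! k \<rhd> \<psi> = t k"
    using product_lift2[OF P g f t(1)] by blast
  have "\<psi> \<bullet> \<phi> = Id2 D f"
    by (rule product_eqI2[OF P VComp_in[OF \<phi>(1) \<psi>(1)] Id2_in[OF f]])
      (simp add: whiskl_VComp[OF \<phi>(1) \<psi>(1) p(3)] \<phi>(2) \<psi>(2) t(2) HComp_Id2[OF f p(3)])
  moreover have "\<phi> \<bullet> \<psi> = Id2 D g"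
    by (rule product_eqI2[OF P VComp_in[OF \<psi>(1) \<phi>(1)] Id2_in[OF g]])
      (simp add: whiskl_VComp[OF \<psi>(1) \<phi>(1) p(3)] \<phi>(2) \<psi>(2) t(3) HComp_Id2[OF g p(3)])
  ultimately have "\<phi> \<in> isos2 X P f g" by (rule isos2I[OF \<phi>(1) \<psi>(1)])
  then show ?thesis using \<phi>(2) by (rule that)
qed

text \<open>A quasi-inverse \<open>g\<close> is the product of quasi-inverses
  \<open>\<beta> k\<close> of the factors. Since \<open>g\<close> and \<open>h\<close> commute
  strictly with the projections, the invertible 2-cells of the factors, whiskered with the
  projections, have the endpoints needed to lift to invertible 2-cells from
  \<open>g \<odot> h\<close> and \<open>h \<odot> g\<close> to the identities.\<close>

lemma equivalence_product:
  assumes P: "is_product (Und D) P As ps" and Q: "is_product (Und D) Q Bs qs"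
    and len: "length As = n" "length Bs = n"
    and eqv: "\<And>k. k < n \<Longrightarrow> is_equivalence D (As ! k) (Bs ! k) (\<alpha> k)"
    and h: "h \<in> hom1 P Q" "\<And>k. k < n \<Longrightarrow> qs ! k \<odot> h = \<alpha> k \<odot> ps ! k"
  shows "is_equivalence D P Q h"
proof -
  note p = is_productD[OF P, unfolded len] and q = is_productD[OF Q, unfolded len]
  have \<alpha>: "\<alpha> k \<in> hom1 (As ! k) (Bs ! k)" if "k < n" for k
    using eqv[OF that] by (simp add: is_equivalence_def)
  have "\<forall>k. \<exists>b x y. k < n \<longrightarrow> b \<in> hom1 (Bs ! k) (As ! k) \<and>
      x \<in> isos2 (As ! k) (As ! k) (b \<odot> \<alpha> k) (Ide (Und D) (As ! k)) \<and>
      y \<in> isos2 (Bs ! k) (Bs ! k) (\<alpha> k \<odot> b) (Ide (Und D) (Bs ! k))"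
    using eqv unfolding is_equivalence_def by blast
  then obtain \<beta> x y where \<beta>: "\<And>k. k < n \<Longrightarrow> \<beta> k \<in> hom1 (Bs ! k) (As ! k)"
    and x: "\<And>k. k < n \<Longrightarrow> x k \<in> isos2 (As ! k) (As ! k) (\<beta> k \<odot> \<alpha> k) (Ide (Und D) (As ! k))"
    and y: "\<And>k. k < n \<Longrightarrow> y k \<in> isos2 (Bs ! k) (Bs ! k) (\<alpha> k \<odot> \<beta> k) (Ide (Und D) (Bs ! k))"
    unfolding choice_iff by blast
  obtain g where g: "g \<in> hom1 Q P" "\<And>k. k < n \<Longrightarrow> ps ! k \<odot> g = \<beta> k \<odot> qs ! k"
    using product_lift[OF P q(1), unfolded len, of "\<lambda>k. \<beta> k \<odot> qs ! k"] U.Comp_in[OF q(3) \<beta>] by auto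
  have gh: "ps ! k \<odot> (g \<odot> h) = (\<beta> k \<odot> \<alpha> k) \<odot> ps ! k" if k: "k < n" for k
  proof -
    have "ps ! k \<odot> (g \<odot> h) = (\<beta> k \<odot> qs ! k) \<odot> h"
      using U.Comp_assoc[OF h(1) g(1) p(3)[OF k]] g(2)[OF k] by simp
    also have "\<dots> = (\<beta> k \<odot> \<alpha> k) \<odot> ps ! k"
      using U.Comp_assoc[OF h(1) q(3)[OF k] \<beta>[OF k]] U.Comp_assoc[OF p(3)[OF k] \<alpha>[OF k] \<beta>[OF k]] h(2)[OF k] by simp
    finally show ?thesis .
  qed
  have hg: "qs ! k \<odot> (h \<odot> g) = (\<alpha> k \<odot> \<beta> k) \<odot> qs ! k" if k: "k < n" for k
  proof -
    have "qs ! k \<odot> (h \<odot> g) = (\<alpha> k \<odot> ps ! k) \<odot> g"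
      using U.Comp_assoc[OF g(1) h(1) q(3)[OF k]] h(2)[OF k] by simp
    also have "\<dots> = (\<alpha> k \<odot> \<beta> k) \<odot> qs ! k"
      using U.Comp_assoc[OF g(1) p(3)[OF k] \<alpha>[OF k]] U.Comp_assoc[OF q(3)[OF k] \<beta>[OF k] \<alpha>[OF k]] g(2)[OF k] by simp
    finally show ?thesis .
  qed
  have "isos2 P P (g \<odot> h) (Ide (Und D) P) \<noteq> {}"
  proof -
    have "x k \<lhd> ps ! k \<in> isos2 P (As ! k) (ps ! k \<odot> (g \<odot> h)) (ps ! k \<odot> Ide (Und D) P)" if k: "k < length As" for k
      using isos2_whiskr[OF x p(3)] gh k len U.Ide_Comp[OF p(3)] U.Comp_Ide[OF p(3)] by simp
    from product_lift2_iso[OF P U.Comp_in[OF h(1) g(1)] U.Ide_in[OF p(1)] this] show ?thesis by blast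
  qed
  moreover have "isos2 Q Q (h \<odot> g) (Ide (Und D) Q) \<noteq> {}"
  proof -
    have "y k \<lhd> qs ! k \<in> isos2 Q (Bs ! k) (qs ! k \<odot> (h \<odot> g)) (qs ! k \<odot> Ide (Und D) Q)" if k: "k < length Bs" for k
      using isos2_whiskr[OF y q(3)] hg k len U.Ide_Comp[OF q(3)] U.Comp_Ide[OF q(3)] by simp
    from product_lift2_iso[OF Q U.Comp_in[OF g(1) h(1)] U.Ide_in[OF q(1)] this] show ?thesis by blast
  qed
  ultimately show ?thesis using h g unfolding is_equivalence_def by blast
qed

end

section \<open>The category of equivalences and pseudo-commuting squares\<close>

text \<open>Freeness of \<open>C\<close> only speaks of categories whose objects and arrows lie in one type; the injection
  \<open>enc\<close> puts squares into the type of arrows of such a category.\<close>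

locale equivalence_squares = fp_two_category D for D :: "('o, 'm, 't) two_cat" +
  fixes enc :: "'m \<times> 'm \<times> 'm \<times> 'm \<times> 't \<Rightarrow> 'e"
  assumes inj_enc: "inj enc"
begin

text \<open>An arrow of \<open>Und D\<close> determines its domain and codomain, so an equivalence
  by itself can serve as an object of \<open>Sq\<close>. Objects thus stay in the type of 1-cells,
  and only arrows need coding.\<close>

definition eqvs :: "'m set" where
  "eqvs = {a \<in> Ar (Und D). is_equivalence D (Dom (Und D) a) (Cod (Und D) a) a}"

text \<open>The 2-cell has the direction used for homotopy homomorphisms and for pseudonatural
  transformations, so their 2-cells enter and leave squares without being inverted.\<close>

definition square :: "'m \<Rightarrow> 'm \<Rightarrow> 'm \<Rightarrow> 'm \<Rightarrow> 't \<Rightarrow> bool" where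
  "square a b f g \<theta> \<longleftrightarrow> a \<in> eqvs \<and> b \<in> eqvs \<and>
     f \<in> hom1 (Dom (Und D) a) (Dom (Und D) b) \<and> g \<in> hom1 (Cod (Und D) a) (Cod (Und D) b) \<and>
     \<theta> \<in> isos2 (Dom (Und D) a) (Cod (Und D) b) (b \<odot> f) (g \<odot> a)"

definition dec :: "'e \<Rightarrow> 'm \<times> 'm \<times> 'm \<times> 'm \<times> 't" where "dec = inv enc"

text \<open>An arrow stores its boundary \<open>a\<close>, \<open>b\<close> so that domain and
  codomain can be read off after decoding. The 2-cell of a composite is the pasting of two squares,
  and its formula is exactly the left-hand side of the composition law for pseudonatural
  transformations.\<close>

definition Sq :: "('m, 'e) cat" where
  "Sq = \<lparr>Ob = eqvs,
     Ar = {x. \<exists>a b f g \<theta>. x = enc (a, b, f, g, \<theta>) \<and> square a b f g \<theta>},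
     Dom = (\<lambda>x. case dec x of (a, b, f, g, \<theta>) \<Rightarrow> a),
     Cod = (\<lambda>x. case dec x of (a, b, f, g, \<theta>) \<Rightarrow> b),
     Ide = (\<lambda>a. enc (a, a, Ide (Und D) (Dom (Und D) a), Ide (Und D) (Cod (Und D) a), Id2 D a)),
     Comp = (\<lambda>y x. case (dec y, dec x) of ((_, c, f', g', \<phi>), (a, _, f, g, \<theta>)) \<Rightarrow>
       enc (a, c, f' \<odot> f, g' \<odot> g, (g' \<rhd> \<theta>) \<bullet> (\<phi> \<lhd> f)))\<rparr>"

lemma dec_enc [simp]: "dec (enc x) = x"
  by (simp add: dec_def inj_enc)

lemma enc_eq [simp]: "enc x = enc y \<longleftrightarrow> x = y"
  using inj_enc by (auto dest: injD)

lemma Ob_Sq [simp]: "Ob Sq = eqvs"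
  by (simp add: Sq_def)

lemma Ide_Sq: "a \<in> hom1 X Y \<Longrightarrow> Ide Sq a = enc (a, a, Ide (Und D) X, Ide (Und D) Y, Id2 D a)"
  by (simp add: Sq_def hom_def)

lemma Comp_Sq:
  "enc (b', c, f', g', \<phi>) \<cdot>\<^bsub>Sq\<^esub> enc (a, b, f, g, \<theta>) = enc (a, c, f' \<odot> f, g' \<odot> g, (g' \<rhd> \<theta>) \<bullet> (\<phi> \<lhd> f))"
  by (simp add: Sq_def)

lemma hom_Sq: "x \<in> hom Sq a b \<longleftrightarrow> (\<exists>f g \<theta>. x = enc (a, b, f, g, \<theta>) \<and> square a b f g \<theta>)"
  by (auto simp: hom_def Sq_def)

lemma hom_SqE:
  assumes "x \<in> hom Sq a b"
  obtains f g \<theta> where "x = enc (a, b, f, g, \<theta>)" "square a b f g \<theta>"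
  using assms by (auto simp: hom_Sq)

lemma eqvsI: "is_equivalence D X Y a \<Longrightarrow> a \<in> eqvs"
  by (auto simp: eqvs_def is_equivalence_def hom_def)

lemma eqvs_hom: "a \<in> eqvs \<Longrightarrow> a \<in> hom1 (Dom (Und D) a) (Cod (Und D) a)"
  by (simp add: eqvs_def hom_def)

lemma eqvs_equivalence: "a \<in> eqvs \<Longrightarrow> is_equivalence D (Dom (Und D) a) (Cod (Und D) a) a"
  by (simp add: eqvs_def)

lemma square_iff:
  assumes "a \<in> hom1 X Y" "b \<in> hom1 X' Y'"
  shows "square a b f g \<theta> \<longleftrightarrow> a \<in> eqvs \<and> b \<in> eqvs \<and> f \<in> hom1 X X' \<and> g \<in> hom1 Y Y' \<and>
    \<theta> \<in> isos2 X Y' (b \<odot> f) (g \<odot> a)"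
  using homD[OF assms(1)] homD[OF assms(2)] by (simp add: square_def)

lemma squareE:
  assumes "square a b f g \<theta>"
  obtains X Y X' Y' where "a \<in> eqvs" "b \<in> eqvs" "a \<in> hom1 X Y" "b \<in> hom1 X' Y'"
    "f \<in> hom1 X X'" "g \<in> hom1 Y Y'" "\<theta> \<in> isos2 X Y' (b \<odot> f) (g \<odot> a)"
  using assms eqvs_hom unfolding square_def by blast

text \<open>The two whiskered 2-cells meet at \<open>g' \<odot> (b \<odot> f)\<close>, the path
  through the common side \<open>b\<close> of the squares. Whiskering and vertical composition
  preserve invertibility.\<close>

lemma square_comp:
  assumes "square a b f g \<theta>" "square b c f' g' \<phi>"
  shows "square a c (f' \<odot> f) (g' \<odot> g) ((g' \<rhd> \<theta>) \<bullet> (\<phi> \<lhd> f))"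
proof -
  obtain X Y X' Y' where t: "a \<in> eqvs" "b \<in> eqvs" "a \<in> hom1 X Y" "b \<in> hom1 X' Y'"
    "f \<in> hom1 X X'" "g \<in> hom1 Y Y'" "\<theta> \<in> isos2 X Y' (b \<odot> f) (g \<odot> a)"
    using assms(1) by (rule squareE)
  have c: "c \<in> eqvs" using assms(2) by (simp add: square_def)
  define X'' Y'' where "X'' = Dom (Und D) c" and "Y'' = Cod (Und D) c"
  have c1: "c \<in> hom1 X'' Y''" using eqvs_hom[OF c] by (simp add: X''_def Y''_def)
  have p: "f' \<in> hom1 X' X''" "g' \<in> hom1 Y' Y''" "\<phi> \<in> isos2 X' Y'' (c \<odot> f') (g' \<odot> b)"
    using assms(2) square_iff[OF t(4) c1] by blast+
  have "\<phi> \<lhd> f \<in> isos2 X Y'' (c \<odot> (f' \<odot> f)) (g' \<odot> (b \<odot> f))"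
    using isos2_whiskr[OF p(3) t(5)] U.Comp_assoc[OF t(5) p(1) c1] U.Comp_assoc[OF t(5,4) p(2)] by simp
  moreover have "g' \<rhd> \<theta> \<in> isos2 X Y'' (g' \<odot> (b \<odot> f)) ((g' \<odot> g) \<odot> a)"
    using isos2_whiskl[OF t(7) p(2)] U.Comp_assoc[OF t(3,6) p(2)] by simp
  ultimately have "(g' \<rhd> \<theta>) \<bullet> (\<phi> \<lhd> f) \<in> isos2 X Y'' (c \<odot> (f' \<odot> f)) ((g' \<odot> g) \<odot> a)"
    by (rule isos2_VComp)
  then show ?thesis
    using square_iff[OF t(3) c1] t(1) c U.Comp_in[OF t(5) p(1)] U.Comp_in[OF t(6) p(2)] by blast
qed

lemma square_Ide:
  assumes "a \<in> eqvs" "a \<in> hom1 X Y"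
  shows "square a a (Ide (Und D) X) (Ide (Und D) Y) (Id2 D a)"
  using square_iff[OF assms(2,2)] assms(1) U.hom_ob[OF assms(2)] U.Ide_in isos2_Id2[OF assms(2)]
    U.Comp_Ide[OF assms(2)] U.Ide_Comp[OF assms(2)] by simp

text \<open>Distributing whiskering over vertical composition turns both sides into a composite of
  three whiskered 2-cells, coming from \<open>\<psi>\<close>, then \<open>\<phi>\<close>, then
  \<open>\<theta>\<close>. Associativity of vertical composition remains, and most of the work lies
  in rebracketing the 1-cells so that the endpoints match.\<close>

lemma square_comp_assoc:
  assumes "square a b f g \<theta>" "square b c f' g' \<phi>" "square c d f'' g'' \<psi>"
  shows "((g'' \<odot> g') \<rhd> \<theta>) \<bullet> (((g'' \<rhd> \<phi>) \<bullet> (\<psi> \<lhd> f')) \<lhd> f)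
    = (g'' \<rhd> ((g' \<rhd> \<theta>) \<bullet> (\<phi> \<lhd> f))) \<bullet> (\<psi> \<lhd> (f' \<odot> f))"
proof -
  obtain X Y X' Y' where t: "a \<in> eqvs" "b \<in> eqvs" "a \<in> hom1 X Y" "b \<in> hom1 X' Y'"
    "f \<in> hom1 X X'" "g \<in> hom1 Y Y'" "\<theta> \<in> isos2 X Y' (b \<odot> f) (g \<odot> a)"
    using assms(1) by (rule squareE)
  have c: "c \<in> eqvs" and d: "d \<in> eqvs" using assms(3) by (auto simp: square_def)
  define V V' W W' where "V = Dom (Und D) c" and "V' = Cod (Und D) c"
    and "W = Dom (Und D) d" and "W' = Cod (Und D) d"
  have cd: "c \<in> hom1 V V'" "d \<in> hom1 W W'" using eqvs_hom[OF c] eqvs_hom[OF d] by (simp_all add: V_def V'_def W_def W'_def)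
  have p: "f' \<in> hom1 X' V" "g' \<in> hom1 Y' V'" "\<phi> \<in> isos2 X' V' (c \<odot> f') (g' \<odot> b)"
    using assms(2) square_iff[OF t(4) cd(1)] by blast+
  have q: "f'' \<in> hom1 V W" "g'' \<in> hom1 V' W'" "\<psi> \<in> isos2 V W' (d \<odot> f'') (g'' \<odot> c)"
    using assms(3) square_iff[OF cd] by blast+
  note \<theta> = isos2_hom2[OF t(7)] and \<phi> = isos2_hom2[OF p(3)] and \<psi> = isos2_hom2[OF q(3)]
  have 1: "\<psi> \<lhd> f' \<in> hom2 X' W' (d \<odot> f'' \<odot> f') (g'' \<odot> (c \<odot> f'))"
    using whiskr_in[OF \<psi> p(1)] U.Comp_assoc[OF p(1) cd(1) q(2)] by simp
  have 2: "g'' \<rhd> \<phi> \<in> hom2 X' W' (g'' \<odot> (c \<odot> f')) (g'' \<odot> (g' \<odot> b))"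
    using whiskl_in[OF \<phi> q(2)] .
  have 3: "\<phi> \<lhd> f \<in> hom2 X V' (c \<odot> f' \<odot> f) (g' \<odot> (b \<odot> f))"
    using whiskr_in[OF \<phi> t(5)] U.Comp_assoc[OF t(5,4) p(2)] by simp
  have 4: "g' \<rhd> \<theta> \<in> hom2 X V' (g' \<odot> (b \<odot> f)) (g' \<odot> (g \<odot> a))"
    using whiskl_in[OF \<theta> p(2)] .
  have 5: "g'' \<rhd> (\<phi> \<lhd> f) \<in> hom2 X W' (g'' \<odot> (c \<odot> f') \<odot> f) (g'' \<odot> (g' \<odot> (b \<odot> f)))"
    using whiskl_in[OF 3 q(2)] U.Comp_assoc[OF t(5) U.Comp_in[OF p(1) cd(1)] q(2)] by simp
  have "((g'' \<rhd> \<phi>) \<bullet> (\<psi> \<lhd> f')) \<lhd> f = (g'' \<rhd> (\<phi> \<lhd> f)) \<bullet> (\<psi> \<lhd> (f' \<odot> f))"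
    using whiskr_VComp[OF 1 2 t(5)] whiskl_whiskr[OF \<phi> t(5) q(2)] whiskr_whiskr[OF \<psi> t(5) p(1)] by simp
  moreover have "g'' \<rhd> ((g' \<rhd> \<theta>) \<bullet> (\<phi> \<lhd> f)) = ((g'' \<odot> g') \<rhd> \<theta>) \<bullet> (g'' \<rhd> (\<phi> \<lhd> f))"
    using whiskl_VComp[OF 3 4 q(2)] whiskl_whiskl[OF \<theta> p(2) q(2)] by simp
  moreover have "((g'' \<odot> g') \<rhd> \<theta>) \<bullet> (g'' \<rhd> (\<phi> \<lhd> f)) \<bullet> (\<psi> \<lhd> (f' \<odot> f))
      = ((g'' \<odot> g') \<rhd> \<theta>) \<bullet> ((g'' \<rhd> (\<phi> \<lhd> f)) \<bullet> (\<psi> \<lhd> (f' \<odot> f)))"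
  proof (rule VComp_assoc)
    show "\<psi> \<lhd> (f' \<odot> f) \<in> hom2 X W' (d \<odot> f'' \<odot> f' \<odot> f) (g'' \<odot> (c \<odot> f') \<odot> f)"
      using whiskr_in[OF 1 t(5)] whiskr_whiskr[OF \<psi> t(5) p(1)] by simp
    show "g'' \<rhd> (\<phi> \<lhd> f) \<in> hom2 X W' (g'' \<odot> (c \<odot> f') \<odot> f) (g'' \<odot> (g' \<odot> (b \<odot> f)))" by (rule 5)
    show "(g'' \<odot> g') \<rhd> \<theta> \<in> hom2 X W' (g'' \<odot> (g' \<odot> (b \<odot> f))) (g'' \<odot> (g' \<odot> (g \<odot> a)))"
      using whiskl_in[OF 4 q(2)] whiskl_whiskl[OF \<theta> p(2) q(2)] by simp
  qed
  ultimately show ?thesis by simp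
qed

lemma category_Sq: "category Sq"
proof
  fix x assume "x \<in> Ar Sq"
  then show "Dom Sq x \<in> Ob Sq" "Cod Sq x \<in> Ob Sq" by (auto simp: Sq_def square_def)
next
  fix a assume "a \<in> Ob Sq"
  then show "Ide Sq a \<in> hom Sq a a"
    using Ide_Sq[OF eqvs_hom] square_Ide[OF _ eqvs_hom] by (simp add: hom_Sq)
next
  fix x y a b c assume "x \<in> hom Sq a b" "y \<in> hom Sq b c"
  then show "y \<cdot>\<^bsub>Sq\<^esub> x \<in> hom Sq a c"
    by (auto elim!: hom_SqE simp: Comp_Sq hom_Sq square_comp)
next
  fix x y z a b c d assume "x \<in> hom Sq a b" "y \<in> hom Sq b c" "z \<in> hom Sq c d"
  then obtain f g \<theta> f' g' \<phi> f'' g'' \<psi> where x: "x = enc (a, b, f, g, \<theta>)" "square a b f g \<theta>"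
    and y: "y = enc (b, c, f', g', \<phi>)" "square b c f' g' \<phi>"
    and z: "z = enc (c, d, f'', g'', \<psi>)" "square c d f'' g'' \<psi>"
    unfolding hom_Sq by blast
  have "f'' \<odot> f' \<odot> f = f'' \<odot> (f' \<odot> f)" "g'' \<odot> g' \<odot> g = g'' \<odot> (g' \<odot> g)"
    using x y z by (auto simp: square_def intro!: U.Comp_assoc)
  then show "z \<cdot>\<^bsub>Sq\<^esub> y \<cdot>\<^bsub>Sq\<^esub> x = z \<cdot>\<^bsub>Sq\<^esub> (y \<cdot>\<^bsub>Sq\<^esub> x)"
    using square_comp_assoc[OF x(2) y(2) z(2)] by (simp add: x y z Comp_Sq)
next
  fix x a b assume "x \<in> hom Sq a b"
  then obtain f g \<theta> where x: "x = enc (a, b, f, g, \<theta>)" "square a b f g \<theta>" by (rule hom_SqE)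
  obtain X Y X' Y' where t: "a \<in> eqvs" "b \<in> eqvs" "a \<in> hom1 X Y" "b \<in> hom1 X' Y'"
    "f \<in> hom1 X X'" "g \<in> hom1 Y Y'" "\<theta> \<in> isos2 X Y' (b \<odot> f) (g \<odot> a)"
    using x(2) by (rule squareE)
  note \<theta> = isos2_hom2[OF t(7)]
  have "(g \<rhd> Id2 D a) \<bullet> (\<theta> \<lhd> Ide (Und D) X) = \<theta>"
    using HComp_Id2[OF t(3,6)] whiskr_Ide[OF \<theta>] Id2_VComp[OF \<theta>] by simp
  then show "x \<cdot>\<^bsub>Sq\<^esub> Ide Sq a = x"
    by (simp add: x(1) Ide_Sq[OF t(3)] Comp_Sq U.Comp_Ide[OF t(5)] U.Comp_Ide[OF t(6)])
  have "(Ide (Und D) Y' \<rhd> \<theta>) \<bullet> (Id2 D b \<lhd> f) = \<theta>"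
    using HComp_Id2[OF t(5,4)] whiskl_Ide[OF \<theta>] VComp_Id2[OF \<theta>] by simp
  then show "Ide Sq b \<cdot>\<^bsub>Sq\<^esub> x = x"
    by (simp add: x(1) Ide_Sq[OF t(4)] Comp_Sq U.Ide_Comp[OF t(5)] U.Ide_Comp[OF t(6)])
qed

section \<open>Products of equivalences as products in \<open>Sq\<close>\<close>

lemma Comp_Sq_strict:
  assumes "b \<in> hom1 P' Q'" "p \<in> hom1 P P'" "q \<in> hom1 Q Q'" "f \<in> hom1 X P"
    and "\<phi> \<in> hom2 X Q (h \<odot> f) k" "h \<in> hom1 P Q" "q \<odot> h = b \<odot> p"
  shows "enc (h, b, p, q, Id2 D (b \<odot> p)) \<cdot>\<^bsub>Sq\<^esub> enc (c, h, f, g, \<phi>) = enc (c, b, p \<odot> f, q \<odot> g, q \<rhd> \<phi>)"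
proof -
  \<comment> \<open>The outer square commutes strictly, so its whiskered 2-cell is the identity on
    the source of \<open>q \<rhd> \<phi>\<close>. Pasting with such a square just whiskers
    \<open>\<phi>\<close> by \<open>q\<close>; projection squares are of this kind.\<close>
  have "Id2 D (b \<odot> p) \<lhd> f = Id2 D (q \<odot> (h \<odot> f))"
    using HComp_Id2[OF assms(4) U.Comp_in[OF assms(2,1)]] U.Comp_assoc[OF assms(4,6,3)] assms(7) by simp
  then have "(q \<rhd> \<phi>) \<bullet> (Id2 D (b \<odot> p) \<lhd> f) = q \<rhd> \<phi>"
    using VComp_Id2[OF whiskl_in[OF assms(5,3)]] by simp
  then show ?thesis by (simp add: Comp_Sq)
qed

text \<open>A cone of squares splits into a cone of 1-cells over \<open>P\<close>, a cone of 1-cells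
  over \<open>Q\<close>, and a family of invertible 2-cells. The 1-cells factor by the ordinary
  universal properties and the 2-cells by the two-dimensional one at \<open>Q\<close>. The vertex
  \<open>h\<close> is an object of \<open>Sq\<close> by \<open>equivalence_product\<close>.\<close>

lemma product_Sq:
  assumes as: "set as \<subseteq> eqvs"
    and P: "is_product (Und D) P (map (Dom (Und D)) as) ps"
    and Q: "is_product (Und D) Q (map (Cod (Und D)) as) qs"
    and h: "h \<in> hom1 P Q" "\<And>k. k < length as \<Longrightarrow> qs ! k \<odot> h = as ! k \<odot> ps ! k"
  shows "is_product Sq h as
    (map (\<lambda>k. enc (h, as ! k, ps ! k, qs ! k, Id2 D (as ! k \<odot> ps ! k))) [0..<length as])"
    (is "is_product Sq h as ?rs")
proof -
  note p = is_productD[OF P, simplified] and q = is_productD[OF Q, simplified]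
  have ae: "as ! k \<in> eqvs" if "k < length as" for k using as that by auto
  have ah: "as ! k \<in> hom1 (map (Dom (Und D)) as ! k) (map (Cod (Und D)) as ! k)" if "k < length as" for k
    using eqvs_hom[OF ae] that by simp
  note ah' = ah[simplified nth_map]
  have he: "h \<in> eqvs"
    by (rule eqvsI, rule equivalence_product[OF P Q _ _ _ h])
      (use eqvs_equivalence[OF ae] in auto)
  have lift: "\<And>k X f. k < length as \<Longrightarrow> f \<in> hom1 X P \<Longrightarrow> qs ! k \<odot> (h \<odot> f) = as ! k \<odot> (ps ! k \<odot> f)"
    subgoal for k X f
      using U.Comp_assoc[OF _ h(1) q(3)] U.Comp_assoc[OF _ p(3) ah] h(2) by simp
    done
  show ?thesis
  proof (rule is_productI)
    show "h \<in> Ob Sq" using he by simp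
    show "length ?rs = length as" by simp
    fix k assume k: "k < length as"
    have "square h (as ! k) (ps ! k) (qs ! k) (Id2 D (as ! k \<odot> ps ! k))"
      using square_iff[OF h(1) ah[OF k]] he ae k p(3) q(3) isos2_Id2[OF U.Comp_in[OF p(3) ah]] h(2) by simp
    then show "?rs ! k \<in> hom Sq h (as ! k)" using k by (simp add: hom_Sq)
  next
    fix c F assume c: "c \<in> Ob Sq" and F: "\<And>k. k < length as \<Longrightarrow> F k \<in> hom Sq c (as ! k)"
    have "\<forall>k. \<exists>f g \<theta>. k < length as \<longrightarrow> F k = enc (c, as ! k, f, g, \<theta>) \<and> square c (as ! k) f g \<theta>"
      using F unfolding hom_Sq by blast
    then obtain f g \<theta> where F': "\<And>k. k < length as \<Longrightarrow> F k = enc (c, as ! k, f k, g k, \<theta> k)"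
      and sq: "\<And>k. k < length as \<Longrightarrow> square c (as ! k) (f k) (g k) (\<theta> k)"
      unfolding choice_iff by blast
    define X Y where "X = Dom (Und D) c" and "Y = Cod (Und D) c"
    have c1: "c \<in> hom1 X Y" and ce: "c \<in> eqvs" using eqvs_hom c by (auto simp: X_def Y_def)
    have t: "f k \<in> hom1 X (map (Dom (Und D)) as ! k)" "g k \<in> hom1 Y (map (Cod (Und D)) as ! k)"
      "\<theta> k \<in> isos2 X (map (Cod (Und D)) as ! k) (as ! k \<odot> f k) (g k \<odot> c)" if "k < length as" for k
      using sq[OF that] square_iff[OF c1 ah[OF that]] by blast+
    obtain u where u: "u \<in> hom1 X P" "\<And>k. k < length as \<Longrightarrow> ps ! k \<odot> u = f k"
      using product_lift[OF P U.hom_ob(1)[OF c1], of f] t(1) by auto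
    obtain v where v: "v \<in> hom1 Y Q" "\<And>k. k < length as \<Longrightarrow> qs ! k \<odot> v = g k"
      using product_lift[OF Q U.hom_ob(2)[OF c1], of g] t(2) by auto
    \<comment> \<open>After rewriting, the endpoints of \<open>\<theta> k\<close> are the
      projections of \<open>h \<odot> u\<close> and \<open>v \<odot> c\<close>, so the family lifts
      to a 2-cell filling the square from \<open>c\<close> to \<open>h\<close>.\<close>
    have "\<theta> k \<in> isos2 X (map (Cod (Und D)) as ! k) (qs ! k \<odot> (h \<odot> u)) (qs ! k \<odot> (v \<odot> c))"
      if "k < length (map (Cod (Und D)) as)" for k
      using that t(3)[of k] lift[of k] u v(2)[of k] U.Comp_assoc[OF c1 v(1) q(3)[of k]] by simp
    then obtain \<phi> where \<phi>: "\<phi> \<in> isos2 X Q (h \<odot> u) (v \<odot> c)" "\<And>k. k < length as \<Longrightarrow> qs ! k \<rhd> \<phi> = \<theta> k"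
      using product_lift2_iso[OF Q U.Comp_in[OF u(1) h(1)] U.Comp_in[OF c1 v(1)], of \<theta>] by auto
    have "enc (c, h, u, v, \<phi>) \<in> hom Sq c h"
      using square_iff[OF c1 h(1)] ce he u(1) v(1) \<phi>(1) by (simp add: hom_Sq)
    moreover have "?rs ! k \<cdot>\<^bsub>Sq\<^esub> enc (c, h, u, v, \<phi>) = F k" if k: "k < length as" for k
      using Comp_Sq_strict[OF ah[OF k] _ _ u(1) isos2_hom2[OF \<phi>(1)] h(1) h(2)[OF k]] k p(3) q(3)
        u(2)[OF k] v(2)[OF k] \<phi>(2)[OF k] F'[OF k] by simp
    ultimately show "\<exists>x \<in> hom Sq c h. \<forall>k < length as. ?rs ! k \<cdot>\<^bsub>Sq\<^esub> x = F k" by blast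
  next
    fix c x y assume x: "x \<in> hom Sq c h" and y: "y \<in> hom Sq c h"
      and eq: "\<And>k. k < length as \<Longrightarrow> ?rs ! k \<cdot>\<^bsub>Sq\<^esub> x = ?rs ! k \<cdot>\<^bsub>Sq\<^esub> y"
    obtain f g \<theta> f' g' \<theta>' where x: "x = enc (c, h, f, g, \<theta>)" "square c h f g \<theta>"
      and y: "y = enc (c, h, f', g', \<theta>')" "square c h f' g' \<theta>'"
      using x y unfolding hom_Sq by blast
    have "c \<in> eqvs" using x(2) by (simp add: square_def)
    define X Y where "X = Dom (Und D) c" and "Y = Cod (Und D) c"
    have c1: "c \<in> hom1 X Y" using eqvs_hom \<open>c \<in> eqvs\<close> by (auto simp: X_def Y_def)
    have t: "f \<in> hom1 X P" "g \<in> hom1 Y Q" "\<theta> \<in> isos2 X Q (h \<odot> f) (g \<odot> c)"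
      and t': "f' \<in> hom1 X P" "g' \<in> hom1 Y Q" "\<theta>' \<in> isos2 X Q (h \<odot> f') (g' \<odot> c)"
      using x(2) y(2) square_iff[OF c1 h(1)] by blast+
    note \<theta> = isos2_hom2[OF t(3)] and \<theta>' = isos2_hom2[OF t'(3)]
    have e: "ps ! k \<odot> f = ps ! k \<odot> f' \<and> qs ! k \<odot> g = qs ! k \<odot> g' \<and> qs ! k \<rhd> \<theta> = qs ! k \<rhd> \<theta>'"
      if k: "k < length as" for k
      using eq[OF k] k p(3) q(3) Comp_Sq_strict[OF ah[OF k] _ _ t(1) \<theta> h(1) h(2)[OF k]]
        Comp_Sq_strict[OF ah[OF k] _ _ t'(1) \<theta>' h(1) h(2)[OF k]] by (simp add: x(1) y(1))
    have f: "f = f'" by (rule U.product_eqI[OF P t(1) t'(1)]) (use e in auto)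
    have g: "g = g'" by (rule U.product_eqI[OF Q t(2) t'(2)]) (use e in auto)
    \<comment> \<open>The equalities of \<open>f\<close> with \<open>f'\<close> and of
      \<open>g\<close> with \<open>g'\<close> come first because they make the two 2-cells parallel,
      as \<open>product_eqI2\<close> demands.\<close>
    have "\<theta> = \<theta>'" by (rule product_eqI2[OF Q \<theta>]) (use e \<theta>' f g in auto)
    with f g show "x = y" by (simp add: x y)
  qed
qed

text \<open>The underlying products in \<open>Und D\<close> stay visible in the conclusion, because
  preservation by the two projection functors is verified on precisely these diagrams.\<close>

lemma product_Sq_ex:
  assumes as: "set as \<subseteq> eqvs"
  obtains P ps Q qs h where "is_product (Und D) P (map (Dom (Und D)) as) ps"
    "is_product (Und D) Q (map (Cod (Und D)) as) qs" "h \<in> hom1 P Q"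
    "is_product Sq h as (map (\<lambda>k. enc (h, as ! k, ps ! k, qs ! k, Id2 D (as ! k \<odot> ps ! k))) [0..<length as])"
proof -
  have "set (map (Dom (Und D)) as) \<subseteq> Ob (Und D)" "set (map (Cod (Und D)) as) \<subseteq> Ob (Und D)"
    using as U.Dom_in U.Cod_in by (auto simp: eqvs_def)
  then have "\<exists>P ps. is_product (Und D) P (map (Dom (Und D)) as) ps"
    "\<exists>Q qs. is_product (Und D) Q (map (Cod (Und D)) as) qs"
    using fp_category_Und unfolding fp_category_def by blast+
  then obtain P ps Q qs where P: "is_product (Und D) P (map (Dom (Und D)) as) ps"
    and Q: "is_product (Und D) Q (map (Cod (Und D)) as) qs"
    by blast
  note p = is_productD[OF P, simplified]
  have "as ! k \<odot> ps ! k \<in> hom1 P (Cod (Und D) (as ! k))" if "k < length as" for k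
  proof -
    have "as ! k \<in> eqvs" using as that by auto
    then show ?thesis using U.Comp_in[OF _ eqvs_hom] p(3) that by simp
  qed
  then obtain h where h: "h \<in> hom1 P Q" "\<And>k. k < length as \<Longrightarrow> qs ! k \<odot> h = as ! k \<odot> ps ! k"
    using product_lift[OF Q p(1), of "\<lambda>k. as ! k \<odot> ps ! k"] by auto
  show ?thesis using that[OF P Q h(1) product_Sq[OF as P Q h]] .
qed

lemma fp_category_Sq: "fp_category Sq"
  unfolding fp_category_def
proof (intro conjI allI impI)
  fix as assume "set as \<subseteq> Ob Sq"
  then have "set as \<subseteq> eqvs" by simp
  from product_Sq_ex[OF this] show "\<exists>P ps. is_product Sq P as ps" by blast
qed (fact category_Sq)

section \<open>The domain and codomain functors on \<open>Sq\<close>\<close>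

definition dom_functor :: "('m, 'e, 'o, 'm) ftr" where
  "dom_functor = \<lparr>On_ob = (\<lambda>a\<in>eqvs. Dom (Und D) a),
     On_ar = (\<lambda>x\<in>Ar Sq. case dec x of (a, b, f, g, \<theta>) \<Rightarrow> f)\<rparr>"

definition cod_functor :: "('m, 'e, 'o, 'm) ftr" where
  "cod_functor = \<lparr>On_ob = (\<lambda>a\<in>eqvs. Cod (Und D) a),
     On_ar = (\<lambda>x\<in>Ar Sq. case dec x of (a, b, f, g, \<theta>) \<Rightarrow> g)\<rparr>"

lemma Ar_Sq: "enc (a, b, f, g, \<theta>) \<in> Ar Sq \<longleftrightarrow> square a b f g \<theta>"
  by (auto simp: Sq_def)

lemma On_ob_dom_cod [simp]:
  assumes "a \<in> eqvs"
  shows "On_ob dom_functor a = Dom (Und D) a" "On_ob cod_functor a = Cod (Und D) a"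
  using assms by (simp_all add: dom_functor_def cod_functor_def)

lemma On_ar_dom_cod [simp]:
  assumes "square a b f g \<theta>"
  shows "On_ar dom_functor (enc (a, b, f, g, \<theta>)) = f" "On_ar cod_functor (enc (a, b, f, g, \<theta>)) = g"
  using assms by (simp_all add: dom_functor_def cod_functor_def Ar_Sq)

lemma is_functor_SqI:
  assumes "On_ob F \<in> eqvs \<rightarrow>\<^sub>E Ob (Und D)" "On_ar F \<in> extensional (Ar Sq)"
    and ar: "\<And>a b f g \<theta>. square a b f g \<theta> \<Longrightarrow> On_ar F (enc (a, b, f, g, \<theta>)) \<in> hom1 (On_ob F a) (On_ob F b)"
    and ide: "\<And>a. a \<in> eqvs \<Longrightarrow> On_ar F (Ide Sq a) = Ide (Und D) (On_ob F a)"
    and comp: "\<And>a b c f g \<theta> f' g' \<phi>. square a b f g \<theta> \<Longrightarrow> square b c f' g' \<phi> \<Longrightarrow>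
      On_ar F (enc (a, c, f' \<odot> f, g' \<odot> g, (g' \<rhd> \<theta>) \<bullet> (\<phi> \<lhd> f)))
        = On_ar F (enc (b, c, f', g', \<phi>)) \<odot> On_ar F (enc (a, b, f, g, \<theta>))"
  shows "is_functor Sq (Und D) F"
  unfolding is_functor_def Ob_Sq
proof (intro conjI allI ballI)
  fix a b x assume "x \<in> hom Sq a b"
  then show "On_ar F x \<in> hom1 (On_ob F a) (On_ob F b)" using ar by (auto elim: hom_SqE)
next
  fix a b c x y assume "x \<in> hom Sq a b" "y \<in> hom Sq b c"
  then show "On_ar F (y \<cdot>\<^bsub>Sq\<^esub> x) = On_ar F y \<odot> On_ar F x"
    using comp by (auto elim!: hom_SqE simp: Comp_Sq)
qed (use assms category_Sq category_Und in auto)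

lemma is_functor_dom: "is_functor Sq (Und D) dom_functor"
proof (rule is_functor_SqI)
  show "On_ob dom_functor \<in> eqvs \<rightarrow>\<^sub>E Ob (Und D)"
    using U.Dom_in by (auto simp: dom_functor_def eqvs_def)
  show "On_ar dom_functor \<in> extensional (Ar Sq)" by (simp add: dom_functor_def)
next
  fix a assume "a \<in> eqvs"
  then show "On_ar dom_functor (Ide Sq a) = Ide (Und D) (On_ob dom_functor a)"
    using square_Ide[OF _ eqvs_hom] by (simp add: Ide_Sq[OF eqvs_hom])
qed (simp_all add: square_comp, simp_all add: square_def)

lemma is_functor_cod: "is_functor Sq (Und D) cod_functor"
proof (rule is_functor_SqI)
  show "On_ob cod_functor \<in> eqvs \<rightarrow>\<^sub>E Ob (Und D)"
    using U.Cod_in by (auto simp: cod_functor_def eqvs_def)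
  show "On_ar cod_functor \<in> extensional (Ar Sq)" by (simp add: cod_functor_def)
next
  fix a assume "a \<in> eqvs"
  then show "On_ar cod_functor (Ide Sq a) = Ide (Und D) (On_ob cod_functor a)"
    using square_Ide[OF _ eqvs_hom] by (simp add: Ide_Sq[OF eqvs_hom])
qed (simp_all add: square_comp, simp_all add: square_def)

text \<open>By \<open>fp_functorI\<close> it suffices to look at the products from
  \<open>product_Sq_ex\<close>; the image of such a diagram is the product \<open>P\<close> with
  projections \<open>ps\<close> from which it was built.\<close>

lemma fp_functor_dom: "fp_functor Sq (Und D) dom_functor"
proof (rule fp_functorI[OF is_functor_dom])
  fix as assume "set as \<subseteq> Ob Sq"
  then have as: "set as \<subseteq> eqvs" by simp
  obtain P ps Q qs h where P: "is_product (Und D) P (map (Dom (Und D)) as) ps"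
    and "h \<in> hom1 P Q"
    and S: "is_product Sq h as (map (\<lambda>k. enc (h, as ! k, ps ! k, qs ! k, Id2 D (as ! k \<odot> ps ! k))) [0..<length as])"
      (is "is_product _ _ _ ?rs")
    using product_Sq_ex[OF as] .
  have "On_ob dom_functor h = P" using is_productD(1)[OF S] \<open>h \<in> hom1 P Q\<close> homD by auto
  moreover have "map (On_ob dom_functor) as = map (Dom (Und D)) as" using as by auto
  moreover have "map (On_ar dom_functor) ?rs = ps"
    using is_productD(2)[OF P] is_productD(3)[OF S]
    by (intro nth_equalityI) (auto simp: hom_Sq)
  ultimately show "\<exists>R rs. is_product Sq R as rs \<and>
      is_product (Und D) (On_ob dom_functor R) (map (On_ob dom_functor) as) (map (On_ar dom_functor) rs)"
    using S P by (intro exI[of _ h] exI[of _ ?rs]) (simp only: simp_thms)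
qed

lemma fp_functor_cod: "fp_functor Sq (Und D) cod_functor"
proof (rule fp_functorI[OF is_functor_cod])
  fix as assume "set as \<subseteq> Ob Sq"
  then have as: "set as \<subseteq> eqvs" by simp
  obtain P ps Q qs h where Q: "is_product (Und D) Q (map (Cod (Und D)) as) qs"
    and "h \<in> hom1 P Q"
    and S: "is_product Sq h as (map (\<lambda>k. enc (h, as ! k, ps ! k, qs ! k, Id2 D (as ! k \<odot> ps ! k))) [0..<length as])"
      (is "is_product _ _ _ ?rs")
    using product_Sq_ex[OF as] .
  have "On_ob cod_functor h = Q" using is_productD(1)[OF S] \<open>h \<in> hom1 P Q\<close> homD by auto
  moreover have "map (On_ob cod_functor) as = map (Cod (Und D)) as" using as by auto
  moreover have "map (On_ar cod_functor) ?rs = qs"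
    using is_productD(2)[OF Q] is_productD(3)[OF S]
    by (intro nth_equalityI) (auto simp: hom_Sq)
  ultimately show "\<exists>R rs. is_product Sq R as rs \<and>
      is_product (Und D) (On_ob cod_functor R) (map (On_ob cod_functor) as) (map (On_ar cod_functor) rs)"
    using S Q by (intro exI[of _ h] exI[of _ ?rs]) (simp only: simp_thms)
qed

end

section \<open>Homotopy equivalences and pseudonatural equivalences\<close>

context equivalence_squares
begin

text \<open>Here data that commute only up to isomorphism become a strict interpretation: each
  2-cell \<open>\<alpha>\<^sub>2 x\<close> is absorbed into the arrow that interprets
  \<open>x\<close>. The chosen projections are strictly commuting squares lying over the projections
  chosen by \<open>M\<close> and \<open>N\<close>.\<close>

definition square_interp :: "('s, 'f) signature \<Rightarrow> ('s, 'f, 'o, 'm) interp \<Rightarrow> ('s, 'f, 'o, 'm) interp \<Rightarrow>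
    ('s \<Rightarrow> 'm) \<Rightarrow> ('s list \<times> 's \<times> 'f \<Rightarrow> 't) \<Rightarrow> ('s, 'f, 'm, 'e) interp" where
  "square_interp \<sigma> M N \<alpha> \<alpha>\<^sub>2 =
    \<lparr>I_ob = (\<lambda>As\<in>lists (Sorts \<sigma>). prod_map (Und D) M N \<alpha> As),
     I_pr = (\<lambda>As\<in>lists (Sorts \<sigma>). map (\<lambda>k. enc (prod_map (Und D) M N \<alpha> As, \<alpha> (As ! k),
        I_pr M As ! k, I_pr N As ! k, Id2 D (\<alpha> (As ! k) \<odot> I_pr M As ! k))) [0..<length As]),
     I_op = (\<lambda>x\<in>Ops \<sigma>. enc (prod_map (Und D) M N \<alpha> (fst x), \<alpha> (fst (snd x)), I_op M x, I_op N x, \<alpha>\<^sub>2 x))\<rparr>"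

context
  fixes \<sigma> :: "('s, 'f) signature" and M N \<alpha> \<alpha>\<^sub>2
  assumes M: "is_interp \<sigma> (Und D) M" and N: "is_interp \<sigma> (Und D) N"
    and hh: "homotopy_hom \<sigma> D M N \<alpha> \<alpha>\<^sub>2"
    and eqv: "\<And>A. A \<in> Sorts \<sigma> \<Longrightarrow> is_equivalence D (I_ob M [A]) (I_ob N [A]) (\<alpha> A)"
begin

abbreviation "\<alpha>s \<equiv> prod_map (Und D) M N \<alpha>"
abbreviation "S \<equiv> square_interp \<sigma> M N \<alpha> \<alpha>\<^sub>2"

lemma interp_products:
  assumes "As \<in> lists (Sorts \<sigma>)"
  shows "is_product (Und D) (I_ob M As) (map (\<lambda>A. I_ob M [A]) As) (I_pr M As)"
    "is_product (Und D) (I_ob N As) (map (\<lambda>A. I_ob N [A]) As) (I_pr N As)"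
  using M N assms by (simp_all add: is_interp_def)

lemma \<alpha>_hom: "A \<in> Sorts \<sigma> \<Longrightarrow> \<alpha> A \<in> hom1 (I_ob M [A]) (I_ob N [A])"
  using eqv by (simp add: is_equivalence_def)

lemma \<alpha>s:
  assumes "As \<in> lists (Sorts \<sigma>)"
  shows "\<alpha>s As \<in> hom1 (I_ob M As) (I_ob N As)"
    "k < length As \<Longrightarrow> I_pr N As ! k \<odot> \<alpha>s As = \<alpha> (As ! k) \<odot> I_pr M As ! k"
proof -
  have "\<alpha> A \<in> hom1 (I_ob M [A]) (I_ob N [A])" if "A \<in> set As" for A
    using \<alpha>_hom that assms by auto
  note * = U.prod_map_props[OF interp_products[OF assms] this]
  show "\<alpha>s As \<in> hom1 (I_ob M As) (I_ob N As)" by (rule *(1))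
  show "I_pr N As ! k \<odot> \<alpha>s As = \<alpha> (As ! k) \<odot> I_pr M As ! k" if "k < length As" by (rule *(2)[OF _ that])
qed

text \<open>Both interpretations choose identity projections on one-element sequences, so the
  equation characterizing the product arrow reduces to this one. It reconciles components indexed by
  sorts with objects indexed by sequences.\<close>

lemma \<alpha>s_single:
  assumes "A \<in> Sorts \<sigma>"
  shows "\<alpha>s [A] = \<alpha> A"
proof -
  have "I_pr M [A] = [Ide (Und D) (I_ob M [A])]" "I_pr N [A] = [Ide (Und D) (I_ob N [A])]"
    using M N assms by (auto simp: is_interp_def)
  then show ?thesis
    using \<alpha>s[of "[A]"] assms U.Ide_Comp[OF \<alpha>s(1)[of "[A]"]] U.Comp_Ide[OF \<alpha>_hom[OF assms]] by auto
qed

lemma product_square_interp: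
  assumes "As \<in> lists (Sorts \<sigma>)"
  shows "is_product Sq (I_ob S As) (map (\<lambda>A. I_ob S [A]) As) (I_pr S As)"
proof -
  have As: "set As \<subseteq> Sorts \<sigma>" using assms by auto
  have 1: "map (Dom (Und D)) (map \<alpha> As) = map (\<lambda>A. I_ob M [A]) As"
    "map (Cod (Und D)) (map \<alpha> As) = map (\<lambda>A. I_ob N [A]) As"
    using homD(2,3)[OF \<alpha>_hom] As by (auto simp: subset_iff)
  have 2: "map (\<lambda>A. I_ob S [A]) As = map \<alpha> As"
    using As by (auto simp: square_interp_def \<alpha>s_single subset_iff)
  have 3: "set (map \<alpha> As) \<subseteq> eqvs"
    using As eqvsI[OF eqv] by auto
  have "is_product Sq (\<alpha>s As) (map \<alpha> As) (map (\<lambda>k. enc (\<alpha>s As, map \<alpha> As ! k, I_pr M As ! k, I_pr N As ! k,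
      Id2 D (map \<alpha> As ! k \<odot> I_pr M As ! k))) [0..<length (map \<alpha> As)])"
    by (rule product_Sq[OF 3 _ _ \<alpha>s(1)[OF assms]])
      (simp_all only: 1 interp_products[OF assms], simp add: \<alpha>s(2)[OF assms])
  moreover have "I_pr S As = map (\<lambda>k. enc (\<alpha>s As, map \<alpha> As ! k, I_pr M As ! k, I_pr N As ! k,
      Id2 D (map \<alpha> As ! k \<odot> I_pr M As ! k))) [0..<length (map \<alpha> As)]"
    using assms by (auto simp: square_interp_def)
  moreover have "I_ob S As = \<alpha>s As" using assms by (simp add: square_interp_def)
  ultimately show ?thesis by (simp only: 2)
qed

lemma square_op:
  assumes "(As, B, f) \<in> Ops \<sigma>"
  shows "square (\<alpha>s As) (\<alpha> B) (I_op M (As, B, f)) (I_op N (As, B, f)) (\<alpha>\<^sub>2 (As, B, f))"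
proof -
  have As: "As \<in> lists (Sorts \<sigma>)" and B: "B \<in> Sorts \<sigma>" using assms by (auto simp: Ops_def)
  \<comment> \<open>The product arrow is an equivalence because it is the vertex of a product in
    \<open>Sq\<close>, and the objects of \<open>Sq\<close> are equivalences.\<close>
  have "I_ob S As \<in> eqvs" using is_productD(1)[OF product_square_interp[OF As]] by simp
  then have "\<alpha>s As \<in> eqvs" using As by (simp add: square_interp_def)
  moreover have "\<alpha> B \<in> eqvs" using eqvsI[OF eqv] B by simp
  moreover have "I_op M (As, B, f) \<in> hom1 (I_ob M As) (I_ob M [B])" "I_op N (As, B, f) \<in> hom1 (I_ob N As) (I_ob N [B])"
    using M N assms by (auto simp: is_interp_def)
  moreover have "\<alpha>\<^sub>2 (As, B, f) \<in> isos2 (I_ob M As) (I_ob N [B])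
        (\<alpha> B \<odot> I_op M (As, B, f)) (I_op N (As, B, f) \<odot> \<alpha>s As)"
    using hh assms by (auto simp: homotopy_hom_def)
  ultimately show ?thesis
    using square_iff[OF \<alpha>s(1)[OF As] \<alpha>_hom[OF B]] by blast
qed

lemma is_interp_square_interp: "is_interp \<sigma> Sq S"
  unfolding is_interp_def
proof (intro conjI ballI)
  fix A assume A: "A \<in> Sorts \<sigma>"
  then have "I_pr M [A] = [Ide (Und D) (I_ob M [A])]" "I_pr N [A] = [Ide (Und D) (I_ob N [A])]"
    using M N by (auto simp: is_interp_def)
  \<comment> \<open>Since \<open>\<alpha> A\<close> composed with an identity is
    \<open>\<alpha> A\<close>, the projection square for \<open>[A]\<close> is literally the
    identity arrow of \<open>Sq\<close>.\<close>
  then show "I_pr S [A] = [Ide Sq (I_ob S [A])]"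
    using A by (simp add: square_interp_def \<alpha>s_single Ide_Sq[OF \<alpha>_hom[OF A]] U.Comp_Ide[OF \<alpha>_hom[OF A]])
next
  fix x assume x: "x \<in> Ops \<sigma>"
  obtain As B f where xe: "x = (As, B, f)" by (cases x)
  have "As \<in> lists (Sorts \<sigma>)" "B \<in> Sorts \<sigma>" using x xe by (auto simp: Ops_def)
  then have "I_ob S As = \<alpha>s As" "I_ob S [B] = \<alpha> B" by (simp_all add: square_interp_def \<alpha>s_single)
  moreover have "I_op S x = enc (\<alpha>s As, \<alpha> B, I_op M x, I_op N x, \<alpha>\<^sub>2 x)"
    using x by (simp add: square_interp_def xe)
  ultimately show "case x of (As, B, f) \<Rightarrow> I_op S (As, B, f) \<in> hom Sq (I_ob S As) (I_ob S [B])"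
    using square_op x by (simp add: xe hom_Sq)
qed (use product_square_interp in \<open>simp_all add: square_interp_def\<close>)

text \<open>Lying strictly over \<open>M\<close> and \<open>N\<close> is what allows uniqueness of
  extensions to identify the two projections of a lift to \<open>Sq\<close> with \<open>Mt\<close>
  and \<open>Nt\<close>.\<close>

lemma square_interp_projections:
  "functor_interp \<sigma> dom_functor S = M" "functor_interp \<sigma> cod_functor S = N"
proof -
  have ob: "On_ob dom_functor (I_ob S As) = I_ob M As" "On_ob cod_functor (I_ob S As) = I_ob N As"
    and pr: "map (On_ar dom_functor) (I_pr S As) = I_pr M As" "map (On_ar cod_functor) (I_pr S As) = I_pr N As"
    if As: "As \<in> lists (Sorts \<sigma>)" for As
  proof -
    note P = is_productD[OF product_square_interp[OF As]]
    have S: "I_ob S As = \<alpha>s As" "I_pr S As = map (\<lambda>k. enc (\<alpha>s As, \<alpha> (As ! k),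
        I_pr M As ! k, I_pr N As ! k, Id2 D (\<alpha> (As ! k) \<odot> I_pr M As ! k))) [0..<length As]"
      using As by (simp_all add: square_interp_def)
    show "On_ob dom_functor (I_ob S As) = I_ob M As" "On_ob cod_functor (I_ob S As) = I_ob N As"
      using P(1) homD[OF \<alpha>s(1)[OF As]] by (simp_all add: S)
    have len: "length (I_pr M As) = length As" "length (I_pr N As) = length As"
      using is_productD(2)[OF interp_products(1)[OF As]] is_productD(2)[OF interp_products(2)[OF As]] by simp_all
    have "square (\<alpha>s As) (\<alpha> (As ! k)) (I_pr M As ! k) (I_pr N As ! k) (Id2 D (\<alpha> (As ! k) \<odot> I_pr M As ! k))"
      if "k < length As" for k
      using P(3)[of k] that by (auto simp: S hom_Sq)
    then show "map (On_ar dom_functor) (I_pr S As) = I_pr M As" "map (On_ar cod_functor) (I_pr S As) = I_pr N As"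
      using len by (auto simp: S intro!: nth_equalityI)
  qed
  have op: "On_ar dom_functor (I_op S x) = I_op M x" "On_ar cod_functor (I_op S x) = I_op N x" if "x \<in> Ops \<sigma>" for x
    using that square_op by (cases x, simp add: square_interp_def)+
  show "functor_interp \<sigma> dom_functor S = M"
    by (rule functor_interp_eqI[OF M]) (simp_all add: ob pr op)
  show "functor_interp \<sigma> cod_functor S = N"
    by (rule functor_interp_eqI[OF N]) (simp_all add: ob pr op)
qed

end

text \<open>The components on objects are the objects \<open>On_ob F X\<close>, which are
  equivalences by the choice of \<open>Sq\<close>; the components on arrows are the 2-cells of the
  squares \<open>On_ar F f\<close>. Composition in \<open>Sq\<close> is pasting, so preservation of
  composites and identities by \<open>F\<close> gives the two coherence laws.\<close>

lemma pseudonat_equivalent_of_lift: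
  assumes F: "is_functor C Sq F" and Mt: "comp_functor C dom_functor F = Mt" and Nt: "comp_functor C cod_functor F = Nt"
  shows "pseudonat_equivalent C D Mt Nt"
proof -
  interpret C: category C using is_functorD(1)[OF F] .
  define \<beta>\<^sub>2 where "\<beta>\<^sub>2 f = snd (snd (snd (snd (dec (On_ar F f)))))" for f
  have ob: "On_ob F X \<in> eqvs" "On_ob Mt X = Dom (Und D) (On_ob F X)" "On_ob Nt X = Cod (Und D) (On_ob F X)"
    if "X \<in> Ob C" for X
    using is_functorD(3)[OF F that] that unfolding Mt[symmetric] Nt[symmetric]
    by (simp_all add: comp_functor_def compose_def)
  have ar: "On_ar F f = enc (On_ob F X, On_ob F Y, On_ar Mt f, On_ar Nt f, \<beta>\<^sub>2 f)"
    "square (On_ob F X) (On_ob F Y) (On_ar Mt f) (On_ar Nt f) (\<beta>\<^sub>2 f)"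
    if f: "f \<in> hom C X Y" for f X Y
  proof -
    obtain p q \<theta> where *: "On_ar F f = enc (On_ob F X, On_ob F Y, p, q, \<theta>)" "square (On_ob F X) (On_ob F Y) p q \<theta>"
      using is_functorD(4)[OF F f] by (rule hom_SqE)
    moreover have "On_ar Mt f = p" "On_ar Nt f = q"
      using * homD(1)[OF f] unfolding Mt[symmetric] Nt[symmetric]
      by (simp_all add: comp_functor_def compose_def)
    moreover have "\<beta>\<^sub>2 f = \<theta>" using * by (simp add: \<beta>\<^sub>2_def)
    ultimately show "On_ar F f = enc (On_ob F X, On_ob F Y, On_ar Mt f, On_ar Nt f, \<beta>\<^sub>2 f)"
      "square (On_ob F X) (On_ob F Y) (On_ar Mt f) (On_ar Nt f) (\<beta>\<^sub>2 f)" by simp_all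
  qed
  have "pseudonat_trans C D Mt Nt (On_ob F) \<beta>\<^sub>2"
    unfolding pseudonat_trans_def
  proof (intro conjI allI ballI)
    show "is_functor C (Und D) Mt" "is_functor C (Und D) Nt"
      using is_functor_comp[OF F is_functor_dom] is_functor_comp[OF F is_functor_cod] Mt Nt by simp_all
  next
    fix X assume "X \<in> Ob C"
    then show "On_ob F X \<in> hom1 (On_ob Mt X) (On_ob Nt X)" using eqvs_hom ob by simp
  next
    fix X Y f assume f: "f \<in> hom C X Y"
    show "\<beta>\<^sub>2 f \<in> isos2 (On_ob Mt X) (On_ob Nt Y) (On_ob F Y \<odot> On_ar Mt f) (On_ar Nt f \<odot> On_ob F X)"
      using ar(2)[OF f] ob C.hom_ob[OF f] by (simp add: square_def)
  next
    fix X Y Z f g assume f: "f \<in> hom C X Y" and g: "g \<in> hom C Y Z"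
    have "On_ar F (g \<cdot>\<^bsub>C\<^esub> f) = On_ar F g \<cdot>\<^bsub>Sq\<^esub> On_ar F f" by (rule is_functorD(6)[OF F f g])
    then show "(On_ar Nt g \<rhd> \<beta>\<^sub>2 f) \<bullet> (\<beta>\<^sub>2 g \<lhd> On_ar Mt f) = \<beta>\<^sub>2 (g \<cdot>\<^bsub>C\<^esub> f)"
      by (simp add: ar(1)[OF f] ar(1)[OF g] ar(1)[OF C.Comp_in[OF f g]] Comp_Sq)
  next
    fix X assume X: "X \<in> Ob C"
    have "On_ar F (Ide C X) = Ide Sq (On_ob F X)" by (rule is_functorD(5)[OF F X])
    then show "\<beta>\<^sub>2 (Ide C X) = Id2 D (On_ob F X)"
      by (simp add: ar(1)[OF C.Ide_in[OF X]] Ide_Sq[OF eqvs_hom[OF ob(1)[OF X]]])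
  qed
  then show ?thesis
    unfolding pseudonat_equivalent_def using eqvs_equivalence ob by (metis (no_types, lifting))
qed

end

section \<open>The two implications\<close>

lemma homotopy_equivalent_imp_pseudonat_equivalent:
  fixes \<sigma> :: "('s, 'f) signature" and C :: "('u, 'u) cat" and D :: "('u, 'u, 'u) two_cat"
    and enc :: "'u \<times> 'u \<times> 'u \<times> 'u \<times> 'u \<Rightarrow> 'u"
  assumes es: "equivalence_squares D enc" and free: "free_on \<sigma> C i"
    and MN: "is_interp \<sigma> (Und D) M" "is_interp \<sigma> (Und D) N"
    and Mt: "fp_functor C (Und D) Mt" "functor_interp \<sigma> Mt i = M"
    and Nt: "fp_functor C (Und D) Nt" "functor_interp \<sigma> Nt i = N"
    and eqv: "homotopy_equivalent \<sigma> D M N"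
  shows "pseudonat_equivalent C D Mt Nt"
proof -
  interpret equivalence_squares D enc by (rule es)
  obtain \<alpha> \<alpha>\<^sub>2 where \<alpha>: "homotopy_hom \<sigma> D M N \<alpha> \<alpha>\<^sub>2"
    "\<And>A. A \<in> Sorts \<sigma> \<Longrightarrow> is_equivalence D (I_ob M [A]) (I_ob N [A]) (\<alpha> A)"
    using eqv unfolding homotopy_equivalent_def by blast
  \<comment> \<open>With squares coded in \<open>'u\<close>, \<open>Sq\<close> is one of the finite
    product categories over which \<open>free_on\<close> quantifies, so the interpretation in
    squares extends to \<open>C\<close>.\<close>
  obtain F where F: "fp_functor C Sq F" "functor_interp \<sigma> F i = square_interp \<sigma> M N \<alpha> \<alpha>\<^sub>2"
    by (rule free_on_ex[OF free fp_category_Sq is_interp_square_interp[OF MN \<alpha>]])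
  \<comment> \<open>Composing \<open>F\<close> with either projection gives a product-preserving
    functor whose restriction along \<open>i\<close> is \<open>M\<close> or \<open>N\<close>;
    uniqueness then yields strict equality with \<open>Mt\<close> or \<open>Nt\<close>.\<close>
  have C: "category C" and i: "is_interp \<sigma> C i"
    using free by (simp_all add: free_on_def fp_category_def)
  have "comp_functor C dom_functor F = Mt"
    by (rule free_on_unique[OF free fp_category_Und fp_functor_comp[OF F(1) fp_functor_dom] Mt(1)])
      (simp add: functor_interp_comp[OF C i] F(2) square_interp_projections[OF MN \<alpha>] Mt(2))
  moreover have "comp_functor C cod_functor F = Nt"
    by (rule free_on_unique[OF free fp_category_Und fp_functor_comp[OF F(1) fp_functor_cod] Nt(1)])
      (simp add: functor_interp_comp[OF C i] F(2) square_interp_projections[OF MN \<alpha>] Nt(2))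
  ultimately show ?thesis
    using F(1) by (intro pseudonat_equivalent_of_lift) (simp_all add: fp_functor_def)
qed

lemma (in fp_two_category) pseudonat_equivalent_imp_homotopy_equivalent:
  assumes i: "is_interp \<sigma> C i"
    and M: "is_interp \<sigma> (Und D) M" and N: "is_interp \<sigma> (Und D) N"
    and Mt: "functor_interp \<sigma> Mt i = M" and Nt: "functor_interp \<sigma> Nt i = N"
    and eqv: "pseudonat_equivalent C D Mt Nt"
  shows "homotopy_equivalent \<sigma> D M N"
proof -
  obtain \<beta> \<beta>\<^sub>2 where \<beta>: "pseudonat_trans C D Mt Nt \<beta> \<beta>\<^sub>2"
    and \<beta>e: "\<And>X. X \<in> Ob C \<Longrightarrow> is_equivalence D (On_ob Mt X) (On_ob Nt X) (\<beta> X)"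
    using eqv unfolding pseudonat_equivalent_def by blast
  have \<beta>1: "\<And>X. X \<in> Ob C \<Longrightarrow> \<beta> X \<in> hom1 (On_ob Mt X) (On_ob Nt X)"
    and \<beta>2: "\<And>X Y f. f \<in> hom C X Y \<Longrightarrow> \<beta>\<^sub>2 f \<in> isos2 (On_ob Mt X) (On_ob Nt Y)
        (\<beta> Y \<odot> On_ar Mt f) (On_ar Nt f \<odot> \<beta> X)"
    using \<beta> unfolding pseudonat_trans_def by blast+
  \<comment> \<open>Only the components of \<open>\<beta>\<close> at sorts are retained; on longer
    sequences a homotopy homomorphism uses the product of these components instead of
    \<open>\<beta>\<close> itself.\<close>
  define \<alpha> where "\<alpha> A = \<beta> (I_ob i [A])" for A
  have iP: "is_product C (I_ob i As) (map (\<lambda>A. I_ob i [A]) As) (I_pr i As)"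
    and MP: "is_product (Und D) (I_ob M As) (map (\<lambda>A. I_ob M [A]) As) (I_pr M As)"
    and NP: "is_product (Und D) (I_ob N As) (map (\<lambda>A. I_ob N [A]) As) (I_pr N As)"
    if "As \<in> lists (Sorts \<sigma>)" for As
    using i M N that by (simp_all add: is_interp_def)
  have iob: "I_ob i As \<in> Ob C" if "As \<in> lists (Sorts \<sigma>)" for As
    using is_productD(1)[OF iP[OF that]] .
  have ob: "I_ob M As = On_ob Mt (I_ob i As)" "I_ob N As = On_ob Nt (I_ob i As)"
    and pr: "I_pr M As = map (On_ar Mt) (I_pr i As)" "I_pr N As = map (On_ar Nt) (I_pr i As)"
    if "As \<in> lists (Sorts \<sigma>)" for As
    unfolding Mt[symmetric] Nt[symmetric] using that by (simp_all add: functor_interp_def)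
  have op: "I_op M x = On_ar Mt (I_op i x)" "I_op N x = On_ar Nt (I_op i x)" if "x \<in> Ops \<sigma>" for x
    unfolding Mt[symmetric] Nt[symmetric] using that by (simp_all add: functor_interp_def)
  have \<alpha>e: "is_equivalence D (I_ob M [A]) (I_ob N [A]) (\<alpha> A)" if "A \<in> Sorts \<sigma>" for A
    using \<beta>e[OF iob[of "[A]"]] ob[of "[A]"] that by (simp add: \<alpha>_def)
  then have \<alpha>1: "\<alpha> A \<in> hom1 (I_ob M [A]) (I_ob N [A])" if "A \<in> Sorts \<sigma>" for A
    using that by (simp add: is_equivalence_def)
  \<comment> \<open>At the \<open>k\<close>-th projection, \<open>\<beta>\<^sub>2\<close> starts at
    the component of \<open>\<alpha>\<close> after the projection of \<open>M\<close>, which equals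
    the projection of \<open>N\<close> after the product arrow, and ends at the projection of
    \<open>N\<close> after \<open>\<beta>\<close>. These 2-cells lift to one from the product arrow
    to \<open>\<beta> (I_ob i As)\<close>, and \<open>\<kappa>\<close> is its inverse.\<close>
  have \<kappa>: "\<exists>\<kappa>. \<kappa> \<in> isos2 (I_ob M As) (I_ob N As) (\<beta> (I_ob i As)) (prod_map (Und D) M N \<alpha> As)"
    if As: "As \<in> lists (Sorts \<sigma>)" for As
  proof -
    note p = is_productD[OF iP[OF As], simplified]
    have \<alpha>As: "\<alpha> A \<in> hom1 (I_ob M [A]) (I_ob N [A])" if "A \<in> set As" for A
      using \<alpha>1 that As by auto
    note m = U.prod_map_props[OF MP[OF As] NP[OF As] \<alpha>As]
    have b: "\<beta> (I_ob i As) \<in> hom1 (I_ob M As) (I_ob N As)"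
      using \<beta>1[OF iob[OF As]] ob[OF As] by simp
    have "\<beta>\<^sub>2 (I_pr i As ! k) \<in> isos2 (I_ob M As) (map (\<lambda>A. I_ob N [A]) As ! k)
        (I_pr N As ! k \<odot> prod_map (Und D) M N \<alpha> As) (I_pr N As ! k \<odot> \<beta> (I_ob i As))"
      if "k < length (map (\<lambda>A. I_ob N [A]) As)" for k
    proof -
      have k: "k < length As" and "[As ! k] \<in> lists (Sorts \<sigma>)" using that As by auto
      moreover have "\<beta> (I_ob i [As ! k]) = \<alpha> (As ! k)" by (simp add: \<alpha>_def)
      ultimately show ?thesis
        using \<beta>2[OF p(3), of k] m(2)[OF _ k] ob[OF As] pr[OF As] ob[of "[As ! k]"] p(2) by simp
    qed
    then obtain \<phi> where "\<phi> \<in> isos2 (I_ob M As) (I_ob N As) (prod_map (Und D) M N \<alpha> As) (\<beta> (I_ob i As))"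
      using product_lift2_iso[OF NP[OF As] m(1) b, of "\<lambda>k. \<beta>\<^sub>2 (I_pr i As ! k)"] by blast
    then show ?thesis by (rule isos2_inverse) blast
  qed
  have "\<exists>t. t \<in> isos2 (I_ob M (fst x)) (I_ob N [fst (snd x)])
      (\<alpha> (fst (snd x)) \<odot> I_op M x) (I_op N x \<odot> prod_map (Und D) M N \<alpha> (fst x))" if x: "x \<in> Ops \<sigma>" for x
  proof -
    obtain As B f where xe: "x = (As, B, f)" by (cases x)
    have As: "As \<in> lists (Sorts \<sigma>)" and B: "[B] \<in> lists (Sorts \<sigma>)" using x xe by (auto simp: Ops_def)
    have ix: "I_op i x \<in> hom C (I_ob i As) (I_ob i [B])" and Nx: "I_op N x \<in> hom1 (I_ob N As) (I_ob N [B])"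
      using i N x xe by (auto simp: is_interp_def)
    obtain \<kappa> where "\<kappa> \<in> isos2 (I_ob M As) (I_ob N As) (\<beta> (I_ob i As)) (prod_map (Und D) M N \<alpha> As)"
      using \<kappa>[OF As] by blast
    \<comment> \<open>The 2-cell of \<open>\<beta>\<close> at the operation ends at
      \<open>I_op N x \<odot> \<beta> (I_ob i As)\<close>; following it by the whiskered
      \<open>\<kappa>\<close> replaces \<open>\<beta> (I_ob i As)\<close> by the product
      arrow.\<close>
    from isos2_whiskl[OF this Nx]
    have 1: "I_op N x \<rhd> \<kappa> \<in> isos2 (I_ob M As) (I_ob N [B]) (I_op N x \<odot> \<beta> (I_ob i As)) (I_op N x \<odot> prod_map (Und D) M N \<alpha> As)" .
    have 2: "\<beta>\<^sub>2 (I_op i x) \<in> isos2 (I_ob M As) (I_ob N [B]) (\<alpha> B \<odot> I_op M x) (I_op N x \<odot> \<beta> (I_ob i As))"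
      using \<beta>2[OF ix] ob[OF As] ob[OF B] op[OF x] by (simp add: \<alpha>_def)
    from isos2_VComp[OF 2 1] show ?thesis by (auto simp: xe)
  qed
  then obtain \<alpha>\<^sub>2 where "\<And>x. x \<in> Ops \<sigma> \<Longrightarrow> \<alpha>\<^sub>2 x \<in> isos2 (I_ob M (fst x)) (I_ob N [fst (snd x)])
      (\<alpha> (fst (snd x)) \<odot> I_op M x) (I_op N x \<odot> prod_map (Und D) M N \<alpha> (fst x))"
    by metis
  then have "homotopy_hom \<sigma> D M N \<alpha> \<alpha>\<^sub>2"
    using \<alpha>1 by (auto simp: homotopy_hom_def)
  then show ?thesis using \<alpha>e unfolding homotopy_equivalent_def by blast
qed

text \<open>An infinite set is equinumerous with its square, and nesting a pairing function four
  times codes quintuples. This supplies the injection that realizes \<open>Sq\<close> as a category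
  with arrows in \<open>'u\<close>.\<close>

lemma infinite_quintuple_coding:
  assumes "infinite (UNIV :: 'u set)"
  obtains enc :: "'u \<times> 'u \<times> 'u \<times> 'u \<times> 'u \<Rightarrow> 'u" where "inj enc"
proof -
  obtain p :: "'u \<times> 'u \<Rightarrow> 'u" where "bij_betw p (UNIV \<times> UNIV) UNIV"
    using card_of_Times_same_infinite[OF assms] card_of_ordIso by blast
  then have p: "inj p" by (simp add: bij_betw_def)
  have "inj (\<lambda>(a, b, c, d, e). p (a, p (b, p (c, p (d, e)))))"
    by (rule injI) (auto dest!: injD[OF p])
  then show ?thesis by (rule that)
qed

theorem theorem4p4p6:
  fixes \<sigma> :: "('s, 'f) signature"
    and C :: "('u, 'u) cat" and i :: "('s, 'f, 'u, 'u) interp"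
    and D :: "('u, 'u, 'u) two_cat"
    and M N :: "('s, 'f, 'u, 'u) interp"
    and Mt Nt :: "('u, 'u, 'u, 'u) ftr"
  assumes "infinite (UNIV :: 'u set)"
    and "free_on \<sigma> C i"
    and "two_category D" and "has_finite_2products D"
    and "is_interp \<sigma> (Und D) M" and "is_interp \<sigma> (Und D) N"
    and "fp_functor C (Und D) Mt" and "functor_interp \<sigma> Mt i = M"
    and "fp_functor C (Und D) Nt" and "functor_interp \<sigma> Nt i = N"
  shows "homotopy_equivalent \<sigma> D M N \<longleftrightarrow> pseudonat_equivalent C D Mt Nt"
proof
  obtain enc :: "'u \<times> 'u \<times> 'u \<times> 'u \<times> 'u \<Rightarrow> 'u" where "inj enc"
    using infinite_quintuple_coding[OF assms(1)] .
  then have "equivalence_squares D enc"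
    using assms(3,4) by (simp add: equivalence_squares_def fp_two_category_def
        fp_two_category_axioms_def equivalence_squares_axioms_def)
  then show "pseudonat_equivalent C D Mt Nt" if "homotopy_equivalent \<sigma> D M N"
    using homotopy_equivalent_imp_pseudonat_equivalent assms that by blast
next
  interpret fp_two_category D
    using assms(3,4) by (simp add: fp_two_category_def fp_two_category_axioms_def)
  assume "pseudonat_equivalent C D Mt Nt"
  then show "homotopy_equivalent \<sigma> D M N"
    using pseudonat_equivalent_imp_homotopy_equivalent assms unfolding free_on_def by blast
qed

end
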